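(* Let $\{\tau_j\}_{j\ge1}$ be a sequence of permutations with $|\tau_j|\to\infty$ such that $t(\pi,\tau_j)\to 1/4!$ as $j\to\infty$ for every $\pi\in S_4$. Then for every positive integer $k$ and every $\pi\in S_k$ we have $t(\pi,\tau_j)\to 1/k!$ as $j\to\infty$.
   Context: For a positive integer $k$, $S_k$ denotes the set of permutations of $[k]=\{1,\dots,k\}$, viewed as bijections $[k]\to[k]$; the length of $\pi\in S_k$ is $|\pi|=k$. For $\pi\in S_k$ and $\tau\in S_m$ with $k\le m$, $t(\pi,\tau)$ is the probability that a uniformly random $k$-element subset $X=\{x_1<\dots<x_k\}$ of $[m]$ satisfies: for all $i,j\in[k]$, $\tau(x_i)\le\tau(x_j)$ if and only if $\pi(i)\le\pi(j)$ (i.e. $\tau$ restricted to $X$ is order-isomorphic to $\pi$). For $k>m$ the quantity is not needed since $|\tau_j|\to\infty$. *)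

theory Defs
  imports "HOL-Combinatorics.Permutations" "HOL-Probability.Probability"
begin

text \<open>
  A permutation of length \<open>k\<close> is a function with \<open>\<pi> permutes {1..k}\<close>. Such a
  function is the identity outside \<open>{1..k}\<close> and so does not determine its length; the lengths are
  therefore passed explicitly.
\<close>

text \<open>For finite \<open>X = {x\<^sub>1 < \<dots> < x\<^sub>k}\<close>, \<open>nth_smallest X i\<close> is \<open>x\<^sub>i\<close> (counting from 1).\<close>

definition nth_smallest :: "nat set \<Rightarrow> nat \<Rightarrow> nat" where
  "nth_smallest X i = sorted_list_of_set X ! (i - 1)"

definition induces_pattern :: "nat \<Rightarrow> (nat \<Rightarrow> nat) \<Rightarrow> (nat \<Rightarrow> nat) \<Rightarrow> nat set \<Rightarrow> bool" where
  "induces_pattern k \<pi> \<tau> X \<longleftrightarrow>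
    (\<forall>i\<in>{1..k}. \<forall>j\<in>{1..k}.
      \<tau> (nth_smallest X i) \<le> \<tau> (nth_smallest X j) \<longleftrightarrow> \<pi> i \<le> \<pi> j)"

text \<open>The density \<open>t(\<pi>, \<tau>)\<close> for \<open>|\<pi>| = k\<close> and \<open>|\<tau>| = m\<close>; meaningful only for \<open>k \<le> m\<close>, since
  otherwise there is no \<open>k\<close>-element subset of \<open>{1..m}\<close> to choose.\<close>

definition pattern_density :: "nat \<Rightarrow> (nat \<Rightarrow> nat) \<Rightarrow> nat \<Rightarrow> (nat \<Rightarrow> nat) \<Rightarrow> real" where
  "pattern_density k \<pi> m \<tau> =
    measure_pmf.prob (pmf_of_set {X. X \<subseteq> {1..m} \<and> card X = k}) {X. induces_pattern k \<pi> \<tau> X}"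

end

theory Submission imports Defs begin

text \<open>
  Write \<open>F(x,y)\<close> for the fraction of points of the graph of \<open>\<tau>\<close> below and to the left of \<open>(x,y)\<close>, all
  coordinates being rescaled to \<open>[0,1]\<close>, let \<open>\<mu>\<close> be the uniform measure on the graph and \<open>\<lambda>\<close> the
  uniform measure on the square. The three integrals \<open>\<integral>F\<^sup>2 d\<lambda>\<close>, \<open>\<integral>F\<^sup>2 d\<mu>\<close> and \<open>\<integral>xyF d\<mu>\<close> are
  probabilities of events about the relative order of four random points, so they tend to \<open>1/9\<close>.
  Moreover \<open>\<integral>xyF d\<lambda> = \<integral>(1 - x\<^sup>2)(1 - y\<^sup>2)/4 d\<mu>\<close> up to \<open>o(1)\<close>, so that the only unknown quantity left,
  \<open>\<integral>x\<^sup>2y\<^sup>2 d\<mu>\<close>, cancels in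
  \<open>\<integral>(F - xy)\<^sup>2 d\<lambda> + 1/2 \<integral>(F - xy)\<^sup>2 d\<mu>\<close>, which therefore tends to \<open>0\<close>. Since \<open>F - xy\<close> is Lipschitz, it tends
  to \<open>0\<close> uniformly. Finally, \<open>k\<close> random points of \<open>\<mu>\<close> may be replaced one at a time by random points of
  \<open>\<lambda>\<close>: for fixed other points, inducing \<open>\<pi>\<close> means lying in a certain rectangle, and the two measures
  almost agree on rectangles.
\<close>

subsection \<open>Patterns in ordered tuples\<close>

lemma nth_smallest_bij:
  assumes "finite X" "card X = k"
  shows "bij_betw (nth_smallest X) {1..k} X"
proof -
  have "bij_betw (\<lambda>i. i - 1) {1..k} {..<k}"
    by (rule bij_betw_byWitness[where f'=Suc]) auto
  moreover have "bij_betw ((!) (sorted_list_of_set X)) {..<k} X"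
    by (rule bij_betw_nth) (use assms in auto)
  ultimately have "bij_betw ((!) (sorted_list_of_set X) \<circ> (\<lambda>i. i - 1)) {1..k} X"
    by (rule bij_betw_trans)
  moreover have "(!) (sorted_list_of_set X) \<circ> (\<lambda>i. i - 1) = nth_smallest X"
    by (auto simp: nth_smallest_def fun_eq_iff)
  ultimately show ?thesis by simp
qed

lemma nth_smallest_less:
  assumes "finite X" "card X = k" "i \<in> {1..k}" "j \<in> {1..k}" "i < j"
  shows "nth_smallest X i < nth_smallest X j"
  unfolding nth_smallest_def
  by (rule sorted_wrt_nth_less[OF strict_sorted_list_of_set]) (use assms in auto)

lemma nth_smallest_unique:
  assumes f: "\<And>i j. \<lbrakk>i \<in> {1..k}; j \<in> {1..k}; i < j\<rbrakk> \<Longrightarrow> f i < f j" and i: "i \<in> {1..k}"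
  shows "nth_smallest (f ` {1..k}) i = f i"
proof -
  have "sorted_wrt (<) (map f [1..<Suc k])"
    by (auto simp: sorted_wrt_iff_nth_less simp del: upt_Suc intro!: f)
  then have "sorted_list_of_set (set (map f [1..<Suc k])) = map f [1..<Suc k]"
    unfolding strict_sorted_iff by (intro sorted_list_of_set.idem_if_sorted_distinct) auto
  moreover have "set (map f [1..<Suc k]) = f ` {1..k}" by auto
  ultimately have "sorted_list_of_set (f ` {1..k}) = map f [1..<Suc k]" by simp
  moreover have "map f [1..<Suc k] ! (i - 1) = f i"
    using i by (subst nth_map) (auto simp del: upt_Suc)
  ultimately show ?thesis by (simp only: nth_smallest_def)
qed

text \<open>For injective \<open>\<sigma>\<close> the one-sided implication already fixes the relative order of \<open>x\<close>.\<close>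

definition ordered_like :: "nat \<Rightarrow> (nat \<Rightarrow> nat) \<Rightarrow> (nat \<Rightarrow> nat) \<Rightarrow> bool" where
  "ordered_like k \<sigma> x \<longleftrightarrow> (\<forall>i\<in>{1..k}. \<forall>j\<in>{1..k}. \<sigma> i < \<sigma> j \<longrightarrow> x i < x j)"

lemma ordered_like_le_iff:
  assumes "\<sigma> permutes {1..k}" "ordered_like k \<sigma> x" "i \<in> {1..k}" "j \<in> {1..k}"
  shows "x i \<le> x j \<longleftrightarrow> \<sigma> i \<le> \<sigma> j"
proof -
  have "\<sigma> i < \<sigma> j \<Longrightarrow> x i < x j" "\<sigma> j < \<sigma> i \<Longrightarrow> x j < x i"
    using assms(2-4) by (auto simp: ordered_like_def)
  moreover have "\<sigma> i = \<sigma> j \<Longrightarrow> i = j"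
    using permutes_inj[OF assms(1)] by (simp add: inj_eq)
  ultimately show ?thesis by (cases "\<sigma> i" "\<sigma> j" rule: linorder_cases) auto
qed

text \<open>The relative order of \<open>x\<close> fixes all comparisons between values of the
  permutation, and \<open>\<sigma> i\<close> is recovered from them as the number of indices
  \<open>j\<close> with \<open>\<sigma> j \<le> \<sigma> i\<close>.\<close>

lemma ordered_like_unique:
  assumes s: "\<sigma> permutes {1..k}" "\<sigma>' permutes {1..k}"
    and o: "ordered_like k \<sigma> x" "ordered_like k \<sigma>' x"
  shows "\<sigma> = \<sigma>'"
proof -
  have le: "\<sigma> i \<le> \<sigma> j \<longleftrightarrow> \<sigma>' i \<le> \<sigma>' j" if "i \<in> {1..k}" "j \<in> {1..k}" for i j
    using ordered_like_le_iff[OF s(1) o(1) that] ordered_like_le_iff[OF s(2) o(2) that] by simp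
  have rank: "card {j \<in> {1..k}. \<rho> j \<le> \<rho> i} = \<rho> i" if "\<rho> permutes {1..k}" "i \<in> {1..k}" for \<rho> i
  proof -
    have "\<rho> ` {j \<in> {1..k}. \<rho> j \<le> \<rho> i} = {1..\<rho> i}"
    proof (intro subset_antisym subsetI)
      fix y assume "y \<in> \<rho> ` {j \<in> {1..k}. \<rho> j \<le> \<rho> i}"
      then show "y \<in> {1..\<rho> i}" using permutes_in_image[OF that(1)] by auto
    next
      fix y assume y: "y \<in> {1..\<rho> i}"
      moreover have "\<rho> i \<in> {1..k}" using permutes_in_image[OF that(1)] that(2) by auto
      ultimately have "y \<in> \<rho> ` {1..k}" unfolding permutes_image[OF that(1)] by auto
      then show "y \<in> \<rho> ` {j \<in> {1..k}. \<rho> j \<le> \<rho> i}" using y by auto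
    qed
    then show ?thesis
      by (metis card_atLeastAtMost card_image diff_Suc_1 inj_on_subset permutes_inj subset_UNIV that(1))
  qed
  show ?thesis
  proof
    fix i show "\<sigma> i = \<sigma>' i"
    proof (cases "i \<in> {1..k}")
      case True
      then have "{j \<in> {1..k}. \<sigma> j \<le> \<sigma> i} = {j \<in> {1..k}. \<sigma>' j \<le> \<sigma>' i}" using le by auto
      then show ?thesis using rank[OF s(1) True] rank[OF s(2) True] by simp
    qed (metis s permutes_not_in)
  qed
qed

text \<open>Repeated entries are allowed, so that the coordinates are independent and averages
  factor. For fixed \<open>k\<close> the tuples with ties form a vanishing fraction as
  \<open>m\<close> grows.\<close>

definition tuples :: "nat \<Rightarrow> nat \<Rightarrow> (nat \<Rightarrow> nat) set" where
  "tuples k m = {1..k} \<rightarrow>\<^sub>E {1..m}"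

text \<open>Here \<open>\<sigma> i\<close> is the rank of the \<open>i\<close>-th coordinate, so a
  set and a ranking of the positions determine the tuple; conversely the set is the range of the
  tuple.\<close>

lemma subset_tuple_bij:
  assumes s: "\<sigma> permutes {1..k}"
  shows "bij_betw (\<lambda>X. \<lambda>i\<in>{1..k}. nth_smallest X (\<sigma> i))
    {X. X \<subseteq> {1..m} \<and> card X = k} {x \<in> tuples k m. ordered_like k \<sigma> x}"
proof (rule bij_betw_byWitness[where f' = "\<lambda>x. x ` {1..k}"])
  have sin: "\<sigma> i \<in> {1..k}" if "i \<in> {1..k}" for i using s that permutes_in_image by metis
  show "\<forall>X\<in>{X. X \<subseteq> {1..m} \<and> card X = k}. (\<lambda>i\<in>{1..k}. nth_smallest X (\<sigma> i)) ` {1..k} = X"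
  proof
    fix X assume "X \<in> {X. X \<subseteq> {1..m} \<and> card X = k}"
    then have "nth_smallest X ` {1..k} = X"
      using nth_smallest_bij[of X k] finite_subset by (auto simp: bij_betw_def)
    moreover have "(\<lambda>i\<in>{1..k}. nth_smallest X (\<sigma> i)) ` {1..k} = nth_smallest X ` (\<sigma> ` {1..k})"
      unfolding image_image by (rule image_cong) auto
    ultimately show "(\<lambda>i\<in>{1..k}. nth_smallest X (\<sigma> i)) ` {1..k} = X"
      using permutes_image[OF s] by simp
  qed
  show "(\<lambda>X. \<lambda>i\<in>{1..k}. nth_smallest X (\<sigma> i)) ` {X. X \<subseteq> {1..m} \<and> card X = k}
      \<subseteq> {x \<in> tuples k m. ordered_like k \<sigma> x}"
  proof (rule image_subsetI)
    fix X assume "X \<in> {X. X \<subseteq> {1..m} \<and> card X = k}"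
    then have X: "X \<subseteq> {1..m}" "card X = k" "finite X" using finite_subset by auto
    have "nth_smallest X (\<sigma> i) \<in> {1..m}" if "i \<in> {1..k}" for i
      using bij_betwE[OF nth_smallest_bij[OF X(3,2)]] sin[OF that] X(1) by blast
    then show "(\<lambda>i\<in>{1..k}. nth_smallest X (\<sigma> i)) \<in> {x \<in> tuples k m. ordered_like k \<sigma> x}"
      using nth_smallest_less[OF X(3,2) sin sin] by (auto simp: tuples_def ordered_like_def)
  qed
  have main: "(\<lambda>i\<in>{1..k}. nth_smallest (x ` {1..k}) (\<sigma> i)) = x \<and> x ` {1..k} \<subseteq> {1..m} \<and> card (x ` {1..k}) = k"
    if "x \<in> tuples k m" "ordered_like k \<sigma> x" for x
  proof -
    \<comment> \<open>Undoing the ranking lists the entries of \<open>x\<close> in increasing order,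
      so \<open>nth_smallest_unique\<close> identifies \<open>f\<close> with the enumeration of the
      range.\<close>
    define f where "f = x \<circ> inv \<sigma>"
    have fs: "f (\<sigma> i) = x i" for i using s by (simp add: f_def permutes_inverses)
    have inc: "f i < f j" if "i \<in> {1..k}" "j \<in> {1..k}" "i < j" for i j
      using \<open>ordered_like k \<sigma> x\<close> that permutes_inverses[OF s] permutes_in_image[OF permutes_inv[OF s]]
      unfolding ordered_like_def f_def by simp
    have im: "f ` {1..k} = x ` {1..k}"
      unfolding f_def image_comp[symmetric] permutes_image[OF permutes_inv[OF s]] ..
    have "inj_on f {1..k}" by (rule linorder_inj_onI) (use inc in \<open>auto simp: less_le\<close>)
    then have "card (x ` {1..k}) = k" using im card_image by fastforce
    moreover have "(\<lambda>i\<in>{1..k}. nth_smallest (x ` {1..k}) (\<sigma> i)) = x"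
    proof
      fix i show "(\<lambda>i\<in>{1..k}. nth_smallest (x ` {1..k}) (\<sigma> i)) i = x i"
        using nth_smallest_unique[where f = f, OF inc sin, of i] im fs that(1) by (cases "i \<in> {1..k}") (auto simp: tuples_def)
    qed
    ultimately show ?thesis using that by (auto simp: tuples_def)
  qed
  show "\<forall>x\<in>{x \<in> tuples k m. ordered_like k \<sigma> x}. (\<lambda>i\<in>{1..k}. nth_smallest (x ` {1..k}) (\<sigma> i)) = x"
    using main by blast
  show "(\<lambda>x. x ` {1..k}) ` {x \<in> tuples k m. ordered_like k \<sigma> x} \<subseteq> {X. X \<subseteq> {1..m} \<and> card X = k}"
    using main by blast
qed

lemma card_ordered_tuples:
  assumes "\<sigma> permutes {1..k}"
  shows "card {x \<in> tuples k m. ordered_like k \<sigma> x} = m choose k"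
  using bij_betw_same_card[OF subset_tuple_bij[OF assms, of m]] n_subsets[of "{1..m}" k] by simp

text \<open>Position \<open>i\<close> of the tuple has horizontal rank \<open>\<sigma> i\<close> and
  vertical rank \<open>\<rho> i\<close>, and a pattern sends horizontal rank to vertical rank.
  Reindexing the quantifiers along \<open>\<sigma>\<close> expresses this.\<close>

lemma induces_pattern_iff_ordered_like:
  assumes s: "\<sigma> permutes {1..k}" and r: "\<rho> permutes {1..k}"
  shows "induces_pattern k (\<rho> \<circ> inv \<sigma>) \<tau> X \<longleftrightarrow>
    ordered_like k \<rho> (\<tau> \<circ> (\<lambda>i\<in>{1..k}. nth_smallest X (\<sigma> i)))"
proof -
  have "induces_pattern k (\<rho> \<circ> inv \<sigma>) \<tau> X \<longleftrightarrow>
    (\<forall>i\<in>\<sigma> ` {1..k}. \<forall>j\<in>\<sigma> ` {1..k}.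
      \<tau> (nth_smallest X i) \<le> \<tau> (nth_smallest X j) \<longleftrightarrow> (\<rho> \<circ> inv \<sigma>) i \<le> (\<rho> \<circ> inv \<sigma>) j)"
    unfolding induces_pattern_def permutes_image[OF s] ..
  also have "\<dots> \<longleftrightarrow> (\<forall>i\<in>{1..k}. \<forall>j\<in>{1..k}.
      \<tau> (nth_smallest X (\<sigma> i)) \<le> \<tau> (nth_smallest X (\<sigma> j)) \<longleftrightarrow> \<rho> i \<le> \<rho> j)"
    using permutes_inverses[OF s] by simp
  also have "\<dots> \<longleftrightarrow> (\<forall>i\<in>{1..k}. \<forall>j\<in>{1..k}.
      \<rho> i < \<rho> j \<longrightarrow> \<tau> (nth_smallest X (\<sigma> i)) < \<tau> (nth_smallest X (\<sigma> j)))"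
    (is "?L \<longleftrightarrow> ?R")
  proof
    assume ?L then show ?R by (meson not_le)
  next
    assume R: ?R
    show ?L
    proof (intro ballI)
      fix i j assume ij: "i \<in> {1..k}" "j \<in> {1..k}"
      have "\<rho> i = \<rho> j \<Longrightarrow> i = j" using permutes_inj[OF r] by (simp add: inj_eq)
      then show "\<tau> (nth_smallest X (\<sigma> i)) \<le> \<tau> (nth_smallest X (\<sigma> j)) \<longleftrightarrow> \<rho> i \<le> \<rho> j"
        using R[rule_format, OF ij] R[rule_format, OF ij(2,1)]
        by (cases "\<rho> i" "\<rho> j" rule: linorder_cases) auto
    qed
  qed
  finally show ?thesis by (simp add: ordered_like_def)
qed

text \<open>Summed over all \<open>\<sigma>\<close> and \<open>\<rho>\<close> these sets partition the injective tuples; the pattern they induce is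
  \<open>\<rho> \<circ> inv \<sigma>\<close>.\<close>

definition pattern_tuples :: "nat \<Rightarrow> (nat \<Rightarrow> nat) \<Rightarrow> (nat \<Rightarrow> nat) \<Rightarrow> nat \<Rightarrow> (nat \<Rightarrow> nat) \<Rightarrow> (nat \<Rightarrow> nat) set" where
  "pattern_tuples k \<sigma> \<rho> m \<tau> = {x \<in> tuples k m. ordered_like k \<sigma> x \<and> ordered_like k \<rho> (\<tau> \<circ> x)}"

lemma pattern_density_eq:
  assumes s: "\<sigma> permutes {1..k}" and r: "\<rho> permutes {1..k}" and "k \<le> m"
  shows "pattern_density k (\<rho> \<circ> inv \<sigma>) m \<tau> = card (pattern_tuples k \<sigma> \<rho> m \<tau>) / (m choose k)"
proof -
  let ?S = "{X. X \<subseteq> {1..m} \<and> card X = k}" and ?\<phi> = "\<lambda>X. \<lambda>i\<in>{1..k}. nth_smallest X (\<sigma> i)"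
  have fin: "finite ?S" by simp
  have card: "card ?S = m choose k" using n_subsets[of "{1..m}" k] by simp
  have ne: "?S \<noteq> {}" using card \<open>k \<le> m\<close> by (metis card.empty zero_less_binomial less_irrefl)
  have "bij_betw ?\<phi> {X\<in>?S. induces_pattern k (\<rho> \<circ> inv \<sigma>) \<tau> X} (pattern_tuples k \<sigma> \<rho> m \<tau>)"
  proof -
    have "induces_pattern k (\<rho> \<circ> inv \<sigma>) \<tau> X \<longleftrightarrow> ordered_like k \<rho> (\<tau> \<circ> ?\<phi> X)" for X
      by (rule induces_pattern_iff_ordered_like[OF s r])
    then have "?\<phi> ` {X\<in>?S. induces_pattern k (\<rho> \<circ> inv \<sigma>) \<tau> X}
      = {x \<in> ?\<phi> ` ?S. ordered_like k \<rho> (\<tau> \<circ> x)}" by blast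
    also have "\<dots> = pattern_tuples k \<sigma> \<rho> m \<tau>"
      using subset_tuple_bij[OF s, of m] by (auto simp: bij_betw_def pattern_tuples_def)
    finally have im: "?\<phi> ` {X\<in>?S. induces_pattern k (\<rho> \<circ> inv \<sigma>) \<tau> X} = pattern_tuples k \<sigma> \<rho> m \<tau>" .
    show ?thesis
      by (rule bij_betw_subset[OF subset_tuple_bij[OF s, of m] _ im]) blast
  qed
  then have "card {X\<in>?S. induces_pattern k (\<rho> \<circ> inv \<sigma>) \<tau> X} = card (pattern_tuples k \<sigma> \<rho> m \<tau>)"
    by (rule bij_betw_same_card)
  then show ?thesis
    unfolding pattern_density_def measure_pmf_of_set[OF ne fin] card Int_def by simp
qed

section \<open>Limiting frequencies of events that depend only on relative order\<close>

lemma tendsto_binomial_over_power: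
  "(\<lambda>n. real (n choose k) / real n ^ k) \<longlonglongrightarrow> 1 / fact k"
proof -
  have "(\<lambda>n. real (n - i) / real (k - i) / real n) \<longlonglongrightarrow> 1 / real (k - i)" if "i < k" for i
  proof -
    have "(\<lambda>n. (1 - real i / real n) / real (k - i)) \<longlonglongrightarrow> (1 - 0) / real (k - i)"
      by (intro tendsto_intros lim_const_over_n) (use that in auto)
    then have "(\<lambda>n. (1 - real i / real n) / real (k - i)) \<longlonglongrightarrow> 1 / real (k - i)" by simp
    moreover have "\<forall>\<^sub>F n in sequentially. (1 - real i / real n) / real (k - i) = real (n - i) / real (k - i) / real n"
      using eventually_ge_at_top[of "Suc i"] by eventually_elim (simp add: of_nat_diff field_simps)
    ultimately show ?thesis by (rule Lim_transform_eventually)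
  qed
  then have "(\<lambda>n. \<Prod>i=0..<k. real (n - i) / real (k - i) / real n) \<longlonglongrightarrow> (\<Prod>i=0..<k. 1 / real (k - i))"
    by (intro tendsto_prod) auto
  moreover have "(\<Prod>i=0..<k. 1 / real (k - i)) = 1 / fact k"
    by (simp add: prod_dividef fact_prod_rev)
  moreover have "\<forall>\<^sub>F n in sequentially. (\<Prod>i=0..<k. real (n - i) / real (k - i) / real n) = real (n choose k) / real n ^ k"
    using eventually_ge_at_top[of k] by eventually_elim (simp add: binomial_altdef_of_nat prod_dividef prod.distrib)
  ultimately show ?thesis using Lim_transform_eventually by fastforce
qed

lemma finite_tuples [simp]: "finite (tuples k m)"
  by (simp add: tuples_def finite_PiE)

lemma card_tuples: "card (tuples k m) = m ^ k"
  by (simp add: tuples_def card_PiE)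

lemma finite_pattern_tuples [simp]: "finite (pattern_tuples k \<sigma> \<rho> m \<tau>)"
  by (rule finite_subset[OF _ finite_tuples]) (auto simp: pattern_tuples_def)

lemma tendsto_pattern_tuples:
  fixes \<tau> :: "nat \<Rightarrow> nat \<Rightarrow> nat" and m :: "nat \<Rightarrow> nat"
  assumes m: "filterlim m at_top sequentially"
    and s: "\<sigma> permutes {1..k}" and r: "\<rho> permutes {1..k}"
    and lim: "(\<lambda>j. pattern_density k (\<rho> \<circ> inv \<sigma>) (m j) (\<tau> j)) \<longlonglongrightarrow> c"
  shows "(\<lambda>j. card (pattern_tuples k \<sigma> \<rho> (m j) (\<tau> j)) / real (m j) ^ k) \<longlonglongrightarrow> c / fact k"
proof -
  have "(\<lambda>j. real (m j choose k) / real (m j) ^ k) \<longlonglongrightarrow> 1 / fact k"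
    using filterlim_compose[OF tendsto_binomial_over_power m] .
  from tendsto_mult[OF lim this]
  have "(\<lambda>j. pattern_density k (\<rho> \<circ> inv \<sigma>) (m j) (\<tau> j) * (real (m j choose k) / real (m j) ^ k)) \<longlonglongrightarrow> c / fact k"
    by simp
  moreover have "\<forall>\<^sub>F j in sequentially. pattern_density k (\<rho> \<circ> inv \<sigma>) (m j) (\<tau> j) * (real (m j choose k) / real (m j) ^ k)
      = card (pattern_tuples k \<sigma> \<rho> (m j) (\<tau> j)) / real (m j) ^ k"
  proof -
    have "\<forall>\<^sub>F j in sequentially. k \<le> m j" using m by (simp add: filterlim_at_top)
    then show ?thesis
      by eventually_elim (use pattern_density_eq[OF s r] in \<open>simp add: zero_less_binomial_iff[THEN iffD2]\<close>)
  qed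
  ultimately show ?thesis by (rule Lim_transform_eventually)
qed

text \<open>All pairs \<open>(\<sigma>, \<rho>)\<close> have the same limiting frequency, so the
  horizontal and vertical orders become independent and uniform. Nothing is assumed about
  \<open>E\<close> on tuples with repeated entries: the frequency is squeezed between the share of
  the patterns in \<open>G \<times> H\<close> and one minus the share of the other patterns, and
  both bounds have the same limit.\<close>

lemma tendsto_order_event:
  fixes \<tau> :: "nat \<Rightarrow> nat \<Rightarrow> nat" and m :: "nat \<Rightarrow> nat" and k :: nat
  defines "S \<equiv> {\<sigma>. \<sigma> permutes {1..k}}"
  assumes m: "filterlim m at_top sequentially"
    and lim: "\<And>\<pi>. \<pi> permutes {1..k} \<Longrightarrow> (\<lambda>j. pattern_density k \<pi> (m j) (\<tau> j)) \<longlonglongrightarrow> 1 / fact k"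
    and G: "G \<subseteq> S" and H: "H \<subseteq> S"
    and ev: "\<And>j \<sigma> \<rho> x. \<lbrakk>\<sigma> \<in> S; \<rho> \<in> S; x \<in> pattern_tuples k \<sigma> \<rho> (m j) (\<tau> j)\<rbrakk>
      \<Longrightarrow> E j x \<longleftrightarrow> \<sigma> \<in> G \<and> \<rho> \<in> H"
  shows "(\<lambda>j. card {x \<in> tuples k (m j). E j x} / real (m j) ^ k)
    \<longlonglongrightarrow> (real (card G) / fact k) * (real (card H) / fact k)"
proof -
  have finS: "finite S" by (simp add: S_def finite_permutations)
  have cardS: "card S = fact k" unfolding S_def by (rule card_permutations) auto
  define P where "P j p = pattern_tuples k (fst p) (snd p) (m j) (\<tau> j)" for j p
  have P: "(\<lambda>j. \<Sum>p\<in>A. card (P j p) / real (m j) ^ k) \<longlonglongrightarrow> real (card A) / (fact k * fact k)" if "A \<subseteq> S \<times> S" for A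
  proof -
    have "(\<lambda>j. card (P j p) / real (m j) ^ k) \<longlonglongrightarrow> 1 / fact k / fact k" if "p \<in> A" for p
      unfolding P_def
      by (rule tendsto_pattern_tuples[OF m])
        (use that \<open>A \<subseteq> S \<times> S\<close> in \<open>auto simp: S_def intro!: lim permutes_compose permutes_inv\<close>)
    then have "(\<lambda>j. \<Sum>p\<in>A. card (P j p) / real (m j) ^ k) \<longlonglongrightarrow> (\<Sum>p\<in>A. 1 / fact k / fact k)"
      by (rule tendsto_sum)
    then show ?thesis by (simp add: field_simps)
  qed
  have disj: "P j p \<inter> P j q = {}" if "p \<in> S \<times> S" "q \<in> S \<times> S" "p \<noteq> q" for j p q
  proof (rule ccontr)
    assume "P j p \<inter> P j q \<noteq> {}"
    then obtain x where "x \<in> P j p" "x \<in> P j q" by blast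
    then have "fst p = fst q" "snd p = snd q"
      using that ordered_like_unique by (auto simp: P_def S_def pattern_tuples_def)
    then show False using that(3) by (simp add: prod_eq_iff)
  qed
  have UN: "(\<Sum>p\<in>A. card (P j p) / real (m j) ^ k) = card (\<Union>p\<in>A. P j p) / real (m j) ^ k" if "A \<subseteq> S \<times> S" for A j
  proof -
    have "finite A" using that finS by (meson finite_SigmaI finite_subset)
    then have "card (\<Union>p\<in>A. P j p) = (\<Sum>p\<in>A. card (P j p))"
    proof (rule card_UN_disjoint)
      show "\<forall>p\<in>A. \<forall>q\<in>A. p \<noteq> q \<longrightarrow> P j p \<inter> P j q = {}"
        by (intro ballI impI disj subsetD[OF that])
    qed (simp add: P_def)
    then show ?thesis by (simp add: sum_divide_distrib)
  qed
  let ?E = "\<lambda>j. {x \<in> tuples k (m j). E j x}"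
  let ?C = "S \<times> S - G \<times> H"
  have sub: "G \<times> H \<subseteq> S \<times> S" "?C \<subseteq> S \<times> S" using G H by auto
  have lower: "(\<Sum>p\<in>G\<times>H. card (P j p) / real (m j) ^ k) \<le> card (?E j) / real (m j) ^ k" for j
    unfolding UN[OF sub(1)]
    by (intro divide_right_mono of_nat_mono card_mono) (use G H ev in \<open>auto simp: P_def pattern_tuples_def, blast\<close>)
  have upper: "card (?E j) / real (m j) ^ k \<le> 1 - (\<Sum>p\<in>?C. card (P j p) / real (m j) ^ k)" for j
  \<comment> \<open>The exceptional case divides by zero: every quotient is then \<open>0\<close>,
    and the bound reads \<open>0 \<le> 1\<close>.\<close>
  proof (cases "m j = 0 \<and> k > 0")
    case False
    have "card (?E j) + card (\<Union>p\<in>?C. P j p) = card (?E j \<union> (\<Union>p\<in>?C. P j p))"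
    proof (rule card_Un_disjoint[symmetric])
      have "\<not> E j x" if "p \<in> ?C" "x \<in> P j p" for p x
        using ev[of "fst p" "snd p" x j] that by (auto simp: P_def)
      then show "?E j \<inter> (\<Union>p\<in>?C. P j p) = {}" by blast
    qed (use finS in \<open>auto simp: P_def\<close>)
    also have "\<dots> \<le> card (tuples k (m j))"
      by (rule card_mono) (auto simp: P_def pattern_tuples_def)
    finally have "card (?E j) + card (\<Union>p\<in>?C. P j p) \<le> m j ^ k" unfolding card_tuples .
    then have "real (card (?E j) + card (\<Union>p\<in>?C. P j p)) \<le> real (m j ^ k)" by (rule of_nat_mono)
    then have "real (card (?E j)) + card (\<Union>p\<in>?C. P j p) \<le> real (m j) ^ k"
      unfolding of_nat_add of_nat_power .
    then show ?thesis unfolding UN[OF sub(2)] using False by (cases "k = 0") (auto simp: field_simps)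
  next
    case True
    then show ?thesis unfolding UN[OF sub(2)] by (simp add: power_0_left)
  qed
  have "card ?C = fact k * fact k - card G * card H"
    using finite_subset[OF G finS] finite_subset[OF H finS] sub finS
    by (subst card_Diff_subset) (auto simp: card_cartesian_product cardS)
  moreover have "card G * card H \<le> fact k * fact k"
    using card_mono[OF finS G] card_mono[OF finS H] by (intro mult_le_mono) (auto simp: cardS)
  ultimately have "real (card ?C) = fact k * fact k - real (card G * card H)"
    by (simp add: of_nat_diff)
  \<comment> \<open>This makes the limit of the upper bound agree with that of the lower
    bound.\<close>
  then have C: "1 - real (card ?C) / (fact k * fact k) = (real (card G) / fact k) * (real (card H) / fact k)"
    by (simp add: field_simps)
  show ?thesis
  proof (rule tendsto_sandwich[OF always_eventually always_eventually])
    show "(\<lambda>j. \<Sum>p\<in>G\<times>H. card (P j p) / real (m j) ^ k) \<longlonglongrightarrow> real (card G) / fact k * (real (card H) / fact k)"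
      using P[OF sub(1)] by (simp add: card_cartesian_product)
    show "(\<lambda>j. 1 - (\<Sum>p\<in>?C. card (P j p) / real (m j) ^ k)) \<longlonglongrightarrow> real (card G) / fact k * (real (card H) / fact k)"
      unfolding C[symmetric] by (intro tendsto_diff tendsto_const P[OF sub(2)])
  qed (use lower upper in auto)
qed

text \<open>Exactly one of the three points carries the largest of the three values, which splits
  the permutations into three classes. Composing with a transposition of two of the points shows
  that the classes are equally large.\<close>

lemma card_permutations_max_of_three:
  assumes "finite S" "a \<in> S" "b \<in> S" "c \<in> S" "a \<noteq> b" "a \<noteq> c" "b \<noteq> c"
  shows "3 * card {\<sigma>. \<sigma> permutes S \<and> \<sigma> b \<le> \<sigma> a \<and> \<sigma> c \<le> (\<sigma> a :: 'a :: linorder)} = fact (card S)"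
proof -
  define M where "M a b c = {\<sigma>. \<sigma> permutes S \<and> \<sigma> b \<le> \<sigma> a \<and> \<sigma> c \<le> (\<sigma> a :: 'a)}" for a b c
  have swap: "card (M b a c) = card (M a b c)" if "a \<in> S" "b \<in> S" "c \<in> S" "a \<noteq> c" "b \<noteq> c" for a b c
  proof -
    have t: "Transposition.transpose a b permutes S" by (rule permutes_swap_id) (use that in auto)
    have "bij_betw (\<lambda>\<sigma>. \<sigma> \<circ> Transposition.transpose a b) (M b a c) (M a b c)"
      by (rule bij_betw_byWitness[where f' = "\<lambda>\<sigma>. \<sigma> \<circ> Transposition.transpose a b"])
        (use that in \<open>auto simp: M_def comp_assoc permutes_compose[OF t] \<close>)
    then show ?thesis by (rule bij_betw_same_card)
  qed
  have comm: "M a b c = M a c b" for a b c by (auto simp: M_def)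
  have fin: "finite (M a b c)" for a b c
    by (rule finite_subset[OF _ finite_permutations[OF assms(1)]]) (auto simp: M_def)
  have ne: "\<sigma> x \<noteq> \<sigma> y" if "\<sigma> permutes S" "x \<noteq> y" for \<sigma> x y
    using permutes_inj[OF that(1)] that(2) by (simp add: inj_eq)
  have "{\<sigma>. \<sigma> permutes S} = M a b c \<union> (M b a c \<union> M c a b)"
    by (auto simp: M_def)
  moreover have "M a b c \<inter> (M b a c \<union> M c a b) = {}" "M b a c \<inter> M c a b = {}"
    using ne assms by (auto simp: M_def dest!: antisym)
  ultimately have "card {\<sigma>. \<sigma> permutes S} = card (M a b c) + (card (M b a c) + card (M c a b))"
    by (simp add: card_Un_disjoint fin)
  also have "card (M b a c) = card (M a b c)" using assms by (intro swap) auto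
  also have "card (M c a b) = card (M a b c)" using swap[of a c b] assms comm[of a b c] by auto
  finally show ?thesis using card_permutations[OF refl assms(1)] by (simp add: M_def)
qed

subsection \<open>Sums over tuples\<close>

lemma sum_PiE_insert:
  assumes "i \<notin> I"
  shows "(\<Sum>p\<in>Pi\<^sub>E (insert i I) A. f p) = (\<Sum>a\<in>A i. \<Sum>p\<in>Pi\<^sub>E I A. f (p(i := a)))"
proof -
  have "(\<Sum>p\<in>Pi\<^sub>E (insert i I) A. f p) = (\<Sum>q\<in>A i \<times> Pi\<^sub>E I A. f ((snd q)(i := fst q)))"
    unfolding PiE_insert_eq
    by (subst sum.reindex) (use inj_combinator[OF assms] in \<open>auto simp: case_prod_beta\<close>)
  then show ?thesis by (simp add: sum.cartesian_product case_prod_beta)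
qed

text \<open>A hybrid argument: the coordinates are switched from samples of \<open>A\<close> to
  samples of \<open>B\<close> one at a time, with all others held fixed, and each switch costs at
  most \<open>\<epsilon>\<close>.\<close>

lemma PiE_average_exchange:
  fixes f :: "('i \<Rightarrow> 'p) \<Rightarrow> real" and \<phi> :: "'a \<Rightarrow> 'p" and \<psi> :: "'b \<Rightarrow> 'p" and \<epsilon> :: real
  assumes "finite I" and A: "finite A" "A \<noteq> {}" and B: "finite B" "B \<noteq> {}"
    and "\<And>p q. (\<And>i. i \<in> I \<Longrightarrow> p i = q i) \<Longrightarrow> f p = f q"
    and "\<And>p i. i \<in> I \<Longrightarrow>
      \<bar>(\<Sum>a\<in>A. f (p(i := \<phi> a))) / card A - (\<Sum>b\<in>B. f (p(i := \<psi> b))) / card B\<bar> \<le> \<epsilon>"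
  shows "\<bar>(\<Sum>a\<in>I \<rightarrow>\<^sub>E A. f (\<phi> \<circ> a)) / real (card A) ^ card I
    - (\<Sum>b\<in>I \<rightarrow>\<^sub>E B. f (\<psi> \<circ> b)) / real (card B) ^ card I\<bar> \<le> card I * \<epsilon>"
  using assms(1,6,7)
proof (induction I arbitrary: f rule: finite_induct)
  case empty
  \<comment> \<open>With no coordinates left, \<open>f\<close> is constant, so the possibly
    different default values \<open>\<phi> undefined\<close> and \<open>\<psi> undefined\<close> do
    not matter.\<close>
  have "f p = f q" for p q by (rule empty.prems(1)) auto
  then have "f (\<phi> \<circ> (\<lambda>_. undefined)) = f (\<psi> \<circ> (\<lambda>_. undefined))" .
  then show ?case by simp
next
  case (insert i I)
  define \<alpha> \<beta> where "\<alpha> = real (card A)" and "\<beta> = real (card B)"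
  have pos: "\<alpha> > 0" "\<beta> > 0" using A B by (auto simp: \<alpha>_def \<beta>_def card_gt_0_iff)
  let ?n = "card I"
  \<comment> \<open>The intermediate average: coordinate \<open>i\<close> is still drawn from
    \<open>A\<close>, all others already from \<open>B\<close>. The induction hypothesis compares it
    with the pure \<open>A\<close> average, the hypothesis on single coordinates with the pure
    \<open>B\<close> average.\<close>
  define mid where "mid = (\<Sum>a\<in>A. (\<Sum>b\<in>I \<rightarrow>\<^sub>E B. f ((\<psi> \<circ> b)(i := \<phi> a))) / \<beta> ^ ?n) / \<alpha>"
  have SA: "(\<Sum>a\<in>insert i I \<rightarrow>\<^sub>E A. f (\<phi> \<circ> a)) / \<alpha> ^ card (insert i I)
      = (\<Sum>a\<in>A. (\<Sum>p\<in>I \<rightarrow>\<^sub>E A. f ((\<phi> \<circ> p)(i := \<phi> a))) / \<alpha> ^ ?n) / \<alpha>"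
    using insert.hyps by (simp add: sum_PiE_insert fun_upd_comp sum_divide_distrib divide_divide_eq_left mult.commute)
  have SB: "(\<Sum>b\<in>insert i I \<rightarrow>\<^sub>E B. f (\<psi> \<circ> b)) / \<beta> ^ card (insert i I)
      = (\<Sum>p\<in>I \<rightarrow>\<^sub>E B. (\<Sum>b\<in>B. f ((\<psi> \<circ> p)(i := \<psi> b))) / \<beta>) / \<beta> ^ ?n"
    using insert.hyps
    by (simp add: sum_PiE_insert fun_upd_comp sum_divide_distrib divide_divide_eq_left mult.commute)
      (rule sum.swap)
  have mid: "mid = (\<Sum>p\<in>I \<rightarrow>\<^sub>E B. (\<Sum>a\<in>A. f ((\<psi> \<circ> p)(i := \<phi> a))) / \<alpha>) / \<beta> ^ ?n"
    unfolding mid_def by (simp add: sum_divide_distrib divide_divide_eq_left mult.commute) (rule sum.swap)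
  have "\<bar>(\<Sum>p\<in>I \<rightarrow>\<^sub>E A. f ((\<phi> \<circ> p)(i := \<phi> a))) / \<alpha> ^ ?n - (\<Sum>b\<in>I \<rightarrow>\<^sub>E B. f ((\<psi> \<circ> b)(i := \<phi> a))) / \<beta> ^ ?n\<bar>
      \<le> ?n * \<epsilon>" for a
    unfolding \<alpha>_def \<beta>_def
  proof (rule insert.IH[of "\<lambda>p. f (p(i := \<phi> a))"])
    fix p q :: "'i \<Rightarrow> 'p" assume "\<And>i. i \<in> I \<Longrightarrow> p i = q i"
    then show "f (p(i := \<phi> a)) = f (q(i := \<phi> a))" by (intro insert.prems(1)) auto
  next
    fix p :: "'i \<Rightarrow> 'p" and j assume "j \<in> I"
    then have "i \<noteq> j" using insert.hyps by auto
    then have twist: "p(j := c, i := d) = p(i := d, j := c)" for c d by (auto simp: fun_eq_iff)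
    show "\<bar>(\<Sum>b\<in>A. f (p(j := \<phi> b, i := \<phi> a))) / real (card A)
      - (\<Sum>b\<in>B. f (p(j := \<psi> b, i := \<phi> a))) / real (card B)\<bar> \<le> \<epsilon>"
      using insert.prems(2)[of j "p(i := \<phi> a)"] \<open>j \<in> I\<close> unfolding twist by blast
  qed
  then have "\<bar>\<Sum>a\<in>A. (\<Sum>p\<in>I \<rightarrow>\<^sub>E A. f ((\<phi> \<circ> p)(i := \<phi> a))) / \<alpha> ^ ?n - (\<Sum>b\<in>I \<rightarrow>\<^sub>E B. f ((\<psi> \<circ> b)(i := \<phi> a))) / \<beta> ^ ?n\<bar>
      \<le> (\<Sum>a\<in>A. ?n * \<epsilon>)" by (intro order_trans[OF sum_abs] sum_mono)
  also have "\<dots> = \<alpha> * (?n * \<epsilon>)" by (simp add: \<alpha>_def)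
  finally have "\<bar>(\<Sum>a\<in>insert i I \<rightarrow>\<^sub>E A. f (\<phi> \<circ> a)) / \<alpha> ^ card (insert i I) - mid\<bar> \<le> ?n * \<epsilon>"
    unfolding SA mid_def using pos by (simp add: sum_subtractf flip: diff_divide_distrib) (simp add: abs_divide field_simps)
  moreover have "\<bar>mid - (\<Sum>b\<in>insert i I \<rightarrow>\<^sub>E B. f (\<psi> \<circ> b)) / \<beta> ^ card (insert i I)\<bar> \<le> \<epsilon>"
  proof -
    have "\<bar>\<Sum>p\<in>I \<rightarrow>\<^sub>E B. (\<Sum>a\<in>A. f ((\<psi> \<circ> p)(i := \<phi> a))) / \<alpha> - (\<Sum>b\<in>B. f ((\<psi> \<circ> p)(i := \<psi> b))) / \<beta>\<bar>
      \<le> (\<Sum>p\<in>I \<rightarrow>\<^sub>E B. \<epsilon>)"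
      unfolding \<alpha>_def \<beta>_def by (intro order_trans[OF sum_abs] sum_mono insert.prems(2)) auto
    also have "\<dots> = \<beta> ^ ?n * \<epsilon>" using insert.hyps by (simp add: card_PiE \<beta>_def)
    finally show ?thesis
      unfolding SB mid using pos by (simp add: sum_subtractf flip: diff_divide_distrib) (simp add: abs_divide field_simps)
  qed
  ultimately have "\<bar>(\<Sum>a\<in>insert i I \<rightarrow>\<^sub>E A. f (\<phi> \<circ> a)) / \<alpha> ^ card (insert i I)
      - (\<Sum>b\<in>insert i I \<rightarrow>\<^sub>E B. f (\<psi> \<circ> b)) / \<beta> ^ card (insert i I)\<bar> \<le> ?n * \<epsilon> + \<epsilon>" by linarith
  also have "\<dots> = card (insert i I) * \<epsilon>" using insert.hyps by (simp add: algebra_simps)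
  finally show ?case by (simp only: \<alpha>_def \<beta>_def)
qed

subsection \<open>Discrepancy on rectangles\<close>

text \<open>Unnormalised form of \<open>F\<close>: division by \<open>m\<close> gives its value at
  the rescaled point \<open>(x/m, y/m)\<close>.\<close>

definition dominated :: "(nat \<Rightarrow> nat) \<Rightarrow> nat \<Rightarrow> nat \<Rightarrow> real" where
  "dominated \<tau> x y = (\<Sum>i\<in>{1..x}. of_bool (\<tau> i \<le> y))"

definition discrepancy :: "nat \<Rightarrow> (nat \<Rightarrow> nat) \<Rightarrow> nat \<Rightarrow> nat \<Rightarrow> real" where
  "discrepancy m \<tau> x y = dominated \<tau> x y / m - real x * real y / real m ^ 2"

text \<open>Inclusion-exclusion over the four corners, applied to both the graph count and the area.
  Half-open intervals make the corner values fit without correction terms.\<close>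

lemma rectangle_discrepancy:
  assumes "a \<le> b" "c \<le> d"
  shows "(\<Sum>i\<in>{a<..b}. of_bool (\<tau> i \<in> {c<..d})) / real m - real (b - a) * real (d - c) / real m ^ 2
    = discrepancy m \<tau> b d - discrepancy m \<tau> a d - discrepancy m \<tau> b c + discrepancy m \<tau> a c"
proof -
  have split: "dominated \<tau> b y = dominated \<tau> a y + (\<Sum>i\<in>{a<..b}. of_bool (\<tau> i \<le> y))" for y
  proof -
    have "{1..b} = {1..a} \<union> {a<..b}" using assms(1) by auto
    then show ?thesis unfolding dominated_def by (simp only:) (rule sum.union_disjoint, auto)
  qed
  have "(\<Sum>i\<in>{a<..b}. of_bool (\<tau> i \<le> d)) = (\<Sum>i\<in>{a<..b}. of_bool (\<tau> i \<le> c) + of_bool (\<tau> i \<in> {c<..d}) :: real)"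
    using assms(2) by (intro sum.cong) auto
  then have eq: "(\<Sum>i\<in>{a<..b}. of_bool (\<tau> i \<in> {c<..d})) =
      dominated \<tau> b d - dominated \<tau> a d - dominated \<tau> b c + dominated \<tau> a c"
    using split[of c] split[of d] by (simp add: sum.distrib)
  show ?thesis
    unfolding eq discrepancy_def using assms
    by (simp add: of_nat_diff algebra_simps diff_divide_distrib add_divide_distrib)
qed

lemma order_convex_nat_interval:
  fixes X :: "nat set"
  assumes "X \<subseteq> {1..m}" "\<And>x y z. \<lbrakk>x \<in> X; z \<in> X; x \<le> y; y \<le> z\<rbrakk> \<Longrightarrow> y \<in> X"
  obtains a b where "a \<le> b" "b \<le> m" "X = {a<..b}"
proof (cases "X = {}")
  case True
  then show ?thesis using that[of 0 0] by simp
next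
  case False
  have fin: "finite X" using assms(1) finite_subset by blast
  have "Min X \<in> X" "Max X \<in> X" using fin False by auto
  then have "X = {Min X - 1<..Max X}"
  proof (intro subset_antisym subsetI)
    fix y assume "y \<in> X"
    then have "y \<ge> 1" "Min X \<le> y" "y \<le> Max X" using assms(1) fin by auto
    moreover have "Min X \<ge> 1" using \<open>Min X \<in> X\<close> assms(1) by auto
    ultimately show "y \<in> {Min X - 1<..Max X}" by auto
  next
    fix y assume "y \<in> {Min X - 1<..Max X}"
    then show "y \<in> X" by (intro assms(2)[OF \<open>Min X \<in> X\<close> \<open>Max X \<in> X\<close>]) auto
  qed
  \<comment> \<open>The left endpoint is excluded from the half-open interval, hence the shift by
    one; the subtraction does not truncate because \<open>X\<close> lies in
    \<open>{1..m}\<close>.\<close>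
  moreover have "Min X - 1 \<le> Max X" using \<open>Max X \<in> X\<close> fin Min_le[OF fin] by (simp add: le_diff_conv le_SucI)
  ultimately show ?thesis using that[of "Min X - 1" "Max X"] \<open>Max X \<in> X\<close> assms(1) by auto
qed

text \<open>Within the grid, order-convex sets are intervals, so their product is a rectangle; each
  of its four corners contributes at most \<open>\<delta>\<close>.\<close>

lemma convex_product_discrepancy:
  assumes m: "m > 0" and D: "\<And>x y. \<lbrakk>x \<le> m; y \<le> m\<rbrakk> \<Longrightarrow> \<bar>discrepancy m \<tau> x y\<bar> \<le> \<delta>"
    and t: "\<tau> permutes {1..m}"
    and X: "\<And>x y z. \<lbrakk>x \<in> X; z \<in> X; x \<le> y; y \<le> z\<rbrakk> \<Longrightarrow> y \<in> X"
    and Y: "\<And>x y z. \<lbrakk>x \<in> Y; z \<in> Y; x \<le> y; y \<le> z\<rbrakk> \<Longrightarrow> y \<in> Y"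
  shows "\<bar>(\<Sum>x\<in>{1..m}. of_bool (x \<in> X \<and> \<tau> x \<in> Y)) / real (card {1..m})
    - (\<Sum>(x,y)\<in>{1..m}\<times>{1..m}. of_bool (x \<in> X \<and> y \<in> Y)) / real (card ({1..m} \<times> {1..m}))\<bar> \<le> 4 * \<delta>"
proof -
  obtain a b where ab: "a \<le> b" "b \<le> m" "X \<inter> {1..m} = {a<..b}"
    by (rule order_convex_nat_interval[of "X \<inter> {1..m}" m]) (auto intro: X)
  obtain c d where cd: "c \<le> d" "d \<le> m" "Y \<inter> {1..m} = {c<..d}"
    by (rule order_convex_nat_interval[of "Y \<inter> {1..m}" m]) (auto intro: Y)
  have tin: "\<tau> x \<in> {1..m}" if "x \<in> {1..m}" for x using permutes_in_image[OF t] that by blast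
  have "(\<Sum>x\<in>{1..m}. of_bool (x \<in> X \<and> \<tau> x \<in> Y)) = (\<Sum>x\<in>{1..m}. of_bool (x \<in> {a<..b} \<and> \<tau> x \<in> {c<..d}) :: real)"
    unfolding ab(3)[symmetric] cd(3)[symmetric] using tin by (intro sum.cong) auto
  also have "\<dots> = (\<Sum>x\<in>{a<..b}. of_bool (\<tau> x \<in> {c<..d}))"
    using ab(2) by (intro sum.mono_neutral_cong_right) auto
  finally have 1: "(\<Sum>x\<in>{1..m}. of_bool (x \<in> X \<and> \<tau> x \<in> Y)) = (\<Sum>x\<in>{a<..b}. of_bool (\<tau> x \<in> {c<..d}) :: real)" .
  have "(\<Sum>(x,y)\<in>{1..m}\<times>{1..m}. of_bool (x \<in> X \<and> y \<in> Y)) = (\<Sum>q\<in>{a<..b}\<times>{c<..d}. 1 :: real)"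
    unfolding ab(3)[symmetric] cd(3)[symmetric] by (intro sum.mono_neutral_cong_right) auto
  then have 2: "(\<Sum>(x,y)\<in>{1..m}\<times>{1..m}. of_bool (x \<in> X \<and> y \<in> Y)) = real (b - a) * real (d - c)"
    by simp
  have "\<bar>discrepancy m \<tau> b d - discrepancy m \<tau> a d - discrepancy m \<tau> b c + discrepancy m \<tau> a c\<bar> \<le> 4 * \<delta>"
    using D[of b d] D[of a d] D[of b c] D[of a c] ab cd by linarith
  then show ?thesis
    unfolding 1 2 rectangle_discrepancy[OF ab(1) cd(1), symmetric] by (simp add: power2_eq_square)
qed

text \<open>With the other coordinates fixed, the constraints on coordinate \<open>i\<close> are
  only lower and upper bounds, so the admissible values form an order-convex set.\<close>

lemma ordered_like_upd_convex:
  assumes "ordered_like k \<sigma> (x(i := u))" "ordered_like k \<sigma> (x(i := w))" "u \<le> v" "v \<le> w"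
  shows "ordered_like k \<sigma> (x(i := v))"
  unfolding ordered_like_def
proof (intro ballI impI)
  fix j l assume "j \<in> {1..k}" "l \<in> {1..k}" "\<sigma> j < \<sigma> l"
  then have "(x(i := u)) j < (x(i := u)) l" "(x(i := w)) j < (x(i := w)) l"
    using assms(1,2) unfolding ordered_like_def by blast+
  then show "(x(i := v)) j < (x(i := v)) l"
    using assms(3,4) \<open>\<sigma> j < \<sigma> l\<close> by (auto split: if_splits)
qed

lemma ordered_like_cong:
  assumes "\<And>i. i \<in> {1..k} \<Longrightarrow> x i = y i"
  shows "ordered_like k \<sigma> x \<longleftrightarrow> ordered_like k \<sigma> y"
  using assms by (simp add: ordered_like_def)

text \<open>A tuple of pairs is a pair of tuples, so a product of a function of the first components
  and one of the second components has a factored sum.\<close>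

lemma sum_PiE_Times:
  fixes g h :: "('i \<Rightarrow> 'a) \<Rightarrow> real"
  assumes g: "\<And>x y. (\<And>i. i \<in> I \<Longrightarrow> x i = y i) \<Longrightarrow> g x = g y"
    and h: "\<And>x y. (\<And>i. i \<in> I \<Longrightarrow> x i = y i) \<Longrightarrow> h x = h y"
  shows "(\<Sum>b\<in>I \<rightarrow>\<^sub>E A \<times> A. g (fst \<circ> b) * h (snd \<circ> b)) = (\<Sum>x\<in>I \<rightarrow>\<^sub>E A. g x) * (\<Sum>y\<in>I \<rightarrow>\<^sub>E A. h y)"
proof -
  have "(\<Sum>b\<in>I \<rightarrow>\<^sub>E A \<times> A. g (fst \<circ> b) * h (snd \<circ> b)) = (\<Sum>q\<in>(I \<rightarrow>\<^sub>E A) \<times> (I \<rightarrow>\<^sub>E A). g (fst q) * h (snd q))"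
  proof (rule sum.reindex_bij_witness[where i = "\<lambda>q. \<lambda>j\<in>I. (fst q j, snd q j)"
        and j = "\<lambda>b. (\<lambda>j\<in>I. fst (b j), \<lambda>j\<in>I. snd (b j))"])
    fix b assume b: "b \<in> I \<rightarrow>\<^sub>E A \<times> A"
    show "(\<lambda>j\<in>I. (fst (\<lambda>j\<in>I. fst (b j), \<lambda>j\<in>I. snd (b j)) j, snd (\<lambda>j\<in>I. fst (b j), \<lambda>j\<in>I. snd (b j)) j)) = b"
      using b by (auto simp: fun_eq_iff PiE_def extensional_def)
    show "(\<lambda>j\<in>I. fst (b j), \<lambda>j\<in>I. snd (b j)) \<in> (I \<rightarrow>\<^sub>E A) \<times> (I \<rightarrow>\<^sub>E A)"
      using b by (auto simp: PiE_iff mem_Times_iff)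
    have "g (\<lambda>j\<in>I. fst (b j)) = g (fst \<circ> b)" "h (\<lambda>j\<in>I. snd (b j)) = h (snd \<circ> b)"
      by (auto intro!: g h)
    then show "g (fst (\<lambda>j\<in>I. fst (b j), \<lambda>j\<in>I. snd (b j))) * h (snd (\<lambda>j\<in>I. fst (b j), \<lambda>j\<in>I. snd (b j)))
        = g (fst \<circ> b) * h (snd \<circ> b)" by simp
  next
    fix q assume q: "q \<in> (I \<rightarrow>\<^sub>E A) \<times> (I \<rightarrow>\<^sub>E A)"
    show "(\<lambda>j\<in>I. (fst q j, snd q j)) \<in> I \<rightarrow>\<^sub>E A \<times> A"
      using q by (auto simp: PiE_iff mem_Times_iff)
    show "(\<lambda>j\<in>I. fst ((\<lambda>j\<in>I. (fst q j, snd q j)) j), \<lambda>j\<in>I. snd ((\<lambda>j\<in>I. (fst q j, snd q j)) j)) = q"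
      using q by (auto simp: prod_eq_iff fun_eq_iff PiE_def extensional_def)
  qed
  then show ?thesis by (simp add: sum_product sum.cartesian_product case_prod_beta)
qed

text \<open>Each of the \<open>k\<close> exchanges of a graph point for a uniform point of the
  square costs at most \<open>4 * \<delta>\<close>. For uniform points the horizontal and vertical
  orders are independent, and each prescribed order has probability
  \<open>(m choose k) / m ^ k\<close>, whence the square.\<close>

lemma pattern_tuples_close_to_uniform:
  assumes m: "m > 0" and t: "\<tau> permutes {1..m}" and p: "\<pi> permutes {1..k}"
    and D: "\<And>x y. \<lbrakk>x \<le> m; y \<le> m\<rbrakk> \<Longrightarrow> \<bar>discrepancy m \<tau> x y\<bar> \<le> \<delta>"
  shows "\<bar>card (pattern_tuples k id \<pi> m \<tau>) / real m ^ k - (real (m choose k) / real m ^ k)\<^sup>2\<bar> \<le> k * (4 * \<delta>)"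
proof -
  let ?I = "{1..k}" and ?A = "{1..m}"
  define g h :: "(nat \<Rightarrow> nat) \<Rightarrow> real"
    where "g x = of_bool (ordered_like k id x)" and "h y = of_bool (ordered_like k \<pi> y)" for x y
  define f where "f q = g (fst \<circ> q) * h (snd \<circ> q)" for q :: "nat \<Rightarrow> nat \<times> nat"
  define \<phi> where "\<phi> x = (x, \<tau> x)" for x
  have g: "g x = g y" if "\<And>i. i \<in> ?I \<Longrightarrow> x i = y i" for x y
    using ordered_like_cong[of k x y] that by (simp add: g_def)
  have h: "h x = h y" if "\<And>i. i \<in> ?I \<Longrightarrow> x i = y i" for x y
    using ordered_like_cong[of k x y] that by (simp add: h_def)
  have "\<bar>(\<Sum>a\<in>?I \<rightarrow>\<^sub>E ?A. f (\<phi> \<circ> a)) / real (card ?A) ^ card ?I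
      - (\<Sum>b\<in>?I \<rightarrow>\<^sub>E ?A \<times> ?A. f (id \<circ> b)) / real (card (?A \<times> ?A)) ^ card ?I\<bar> \<le> card ?I * (4 * \<delta>)"
  proof (rule PiE_average_exchange)
    fix p q :: "nat \<Rightarrow> nat \<times> nat" assume "\<And>i. i \<in> ?I \<Longrightarrow> p i = q i"
    then show "f p = f q" unfolding f_def by (auto intro!: arg_cong2[where f = "(*)"] g h)
  next
    fix q :: "nat \<Rightarrow> nat \<times> nat" and i
    \<comment> \<open>\<open>X\<close> and \<open>Y\<close> hold the admissible horizontal and
      vertical positions of the \<open>i\<close>-th point, given the other points.\<close>
    define X where "X = {x. ordered_like k id ((fst \<circ> q)(i := x))}"
    define Y where "Y = {y. ordered_like k \<pi> ((snd \<circ> q)(i := y))}"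
    have "f (q(i := a)) = of_bool (fst a \<in> X \<and> snd a \<in> Y)" for a
      by (simp add: f_def g_def h_def X_def Y_def fun_upd_comp)
    then have eqs: "(\<Sum>a\<in>?A. f (q(i := \<phi> a))) = (\<Sum>x\<in>?A. of_bool (x \<in> X \<and> \<tau> x \<in> Y))"
      "(\<Sum>b\<in>?A \<times> ?A. f (q(i := id b))) = (\<Sum>(x, y)\<in>?A \<times> ?A. of_bool (x \<in> X \<and> y \<in> Y))"
      by (simp_all only: \<phi>_def fst_conv snd_conv id_apply case_prod_beta')
    have X: "y \<in> X" if "x \<in> X" "z \<in> X" "x \<le> y" "y \<le> z" for x y z
      using that ordered_like_upd_convex unfolding X_def mem_Collect_eq by blast
    have Y: "y \<in> Y" if "x \<in> Y" "z \<in> Y" "x \<le> y" "y \<le> z" for x y z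
      using that ordered_like_upd_convex unfolding Y_def mem_Collect_eq by blast
    show "\<bar>(\<Sum>a\<in>?A. f (q(i := \<phi> a))) / real (card ?A)
        - (\<Sum>b\<in>?A \<times> ?A. f (q(i := id b))) / real (card (?A \<times> ?A))\<bar> \<le> 4 * \<delta>"
      unfolding eqs by (rule convex_product_discrepancy[OF m D t]) (assumption | fact X Y)+
  qed (use m in auto)
  moreover have "(\<Sum>a\<in>?I \<rightarrow>\<^sub>E ?A. f (\<phi> \<circ> a)) = card (pattern_tuples k id \<pi> m \<tau>)"
  proof -
    have "(\<Sum>a\<in>?I \<rightarrow>\<^sub>E ?A. f (\<phi> \<circ> a)) = (\<Sum>a\<in>tuples k m. of_bool (a \<in> pattern_tuples k id \<pi> m \<tau>))"
      unfolding tuples_def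
      by (intro sum.cong) (auto simp: f_def g_def h_def \<phi>_def pattern_tuples_def tuples_def comp_def)
    also have "\<dots> = card (tuples k m \<inter> pattern_tuples k id \<pi> m \<tau>)" by simp
    also have "tuples k m \<inter> pattern_tuples k id \<pi> m \<tau> = pattern_tuples k id \<pi> m \<tau>"
      by (auto simp: pattern_tuples_def)
    finally show ?thesis .
  qed
  moreover have "(\<Sum>b\<in>?I \<rightarrow>\<^sub>E ?A \<times> ?A. f (id \<circ> b)) = real (m choose k) * real (m choose k)"
  proof -
    have card: "(\<Sum>x\<in>tuples k m. of_bool (ordered_like k \<sigma> x)) = real (m choose k)"
      if "\<sigma> permutes {1..k}" for \<sigma>
      using card_ordered_tuples[OF that, of m] by (simp add: Int_def)
    have "(\<Sum>b\<in>?I \<rightarrow>\<^sub>E ?A \<times> ?A. f (id \<circ> b)) = (\<Sum>x\<in>tuples k m. g x) * (\<Sum>y\<in>tuples k m. h y)"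
      unfolding f_def id_comp tuples_def by (rule sum_PiE_Times) (use g h in blast)+
    then show ?thesis unfolding g_def h_def card[OF permutes_id] card[OF p] .
  qed
  ultimately show ?thesis by (simp add: power_mult_distrib power2_eq_square)
qed

subsection \<open>Uniform discrepancy from mean square discrepancy\<close>

text \<open>The increment is the difference of two numbers in the interval from \<open>0\<close> to
  \<open>(x' - x) / m\<close>: the share of graph points in a vertical strip and the area of that
  strip below \<open>y\<close>.\<close>

lemma discrepancy_lipschitz_fst:
  assumes "x \<le> x'" "y \<le> m" "m > 0"
  shows "\<bar>discrepancy m \<tau> x' y - discrepancy m \<tau> x y\<bar> \<le> (real x' - real x) / m"
proof -
  have "{1..x'} = {1..x} \<union> {x<..x'}" using assms(1) by auto
  then have "dominated \<tau> x' y = dominated \<tau> x y + (\<Sum>i\<in>{x<..x'}. of_bool (\<tau> i \<le> y))"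
    unfolding dominated_def by (simp only:) (rule sum.union_disjoint, auto)
  moreover define s :: real where "s = (\<Sum>i\<in>{x<..x'}. of_bool (\<tau> i \<le> y))"
  ultimately have eq: "discrepancy m \<tau> x' y - discrepancy m \<tau> x y = s / m - ((real x' - real x) / m) * (real y / m)"
    using assms by (simp add: discrepancy_def field_simps power2_eq_square)
  have "s \<le> (\<Sum>i\<in>{x<..x'}. 1)" unfolding s_def by (intro sum_mono) auto
  then have "s / m \<le> (real x' - real x) / m" using assms by (intro divide_right_mono) (auto simp: of_nat_diff)
  moreover have "0 \<le> s / m" unfolding s_def by (intro divide_nonneg_nonneg sum_nonneg) auto
  moreover have "((real x' - real x) / m) * (real y / m) \<le> (real x' - real x) / m"
    using assms by (intro mult_left_le) auto
  moreover have "0 \<le> ((real x' - real x) / m) * (real y / m)" using assms by simp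
  ultimately show ?thesis unfolding eq by linarith
qed

lemma discrepancy_lipschitz_snd:
  assumes "y \<le> y'" "x \<le> m" "m > 0" "\<tau> permutes {1..m}"
  shows "\<bar>discrepancy m \<tau> x y' - discrepancy m \<tau> x y\<bar> \<le> (real y' - real y) / m"
proof -
  define s :: real where "s = (\<Sum>i\<in>{1..x}. of_bool (\<tau> i \<in> {y<..y'}))"
  have "dominated \<tau> x y' = (\<Sum>i\<in>{1..x}. of_bool (\<tau> i \<le> y) + of_bool (\<tau> i \<in> {y<..y'}))"
    unfolding dominated_def using assms(1) by (intro sum.cong) auto
  then have "dominated \<tau> x y' = dominated \<tau> x y + s"
    by (simp only: sum.distrib dominated_def s_def)
  then have eq: "discrepancy m \<tau> x y' - discrepancy m \<tau> x y = s / m - ((real y' - real y) / m) * (real x / m)"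
    using assms by (simp add: discrepancy_def field_simps power2_eq_square)
  have "s = card {i \<in> {1..x}. \<tau> i \<in> {y<..y'}}" by (simp add: s_def Int_def)
  \<comment> \<open>Injectivity of \<open>\<tau>\<close> is what bounds a horizontal strip: it holds
    at most one point per row.\<close>
  also have "\<dots> = card (\<tau> ` {i \<in> {1..x}. \<tau> i \<in> {y<..y'}})"
    using permutes_inj_on[OF assms(4)] by (simp add: card_image)
  also have "\<dots> \<le> card {y<..y'}" by (intro of_nat_mono card_mono) auto
  finally have "s / m \<le> (real y' - real y) / m" using assms by (intro divide_right_mono) (auto simp: of_nat_diff)
  moreover have "0 \<le> s / m" unfolding s_def by (intro divide_nonneg_nonneg sum_nonneg) auto
  moreover have "((real y' - real y) / m) * (real x / m) \<le> (real y' - real y) / m"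
    using assms by (intro mult_left_le) auto
  moreover have "0 \<le> ((real y' - real y) / m) * (real x / m)" using assms by simp
  ultimately show ?thesis unfolding eq by linarith
qed

lemma discrepancy_lipschitz:
  assumes "x \<le> m" "y \<le> m" "x' \<le> m" "y' \<le> m" "m > 0" "\<tau> permutes {1..m}"
  shows "\<bar>discrepancy m \<tau> x y - discrepancy m \<tau> x' y'\<bar> \<le> (\<bar>real x - real x'\<bar> + \<bar>real y - real y'\<bar>) / m"
proof -
  have "\<bar>discrepancy m \<tau> x y - discrepancy m \<tau> x' y\<bar> \<le> \<bar>real x - real x'\<bar> / m"
    using discrepancy_lipschitz_fst[of x x' y m \<tau>] discrepancy_lipschitz_fst[of x' x y m \<tau>] assms
    by (cases "x \<le> x'") (auto simp: abs_minus_commute)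
  moreover have "\<bar>discrepancy m \<tau> x' y - discrepancy m \<tau> x' y'\<bar> \<le> \<bar>real y - real y'\<bar> / m"
    using discrepancy_lipschitz_snd[of y y' x' m \<tau>] discrepancy_lipschitz_snd[of y' y x' m \<tau>] assms
    by (cases "y \<le> y'") (auto simp: abs_minus_commute)
  ultimately show ?thesis unfolding add_divide_distrib by linarith
qed

text \<open>A one-sided window suffices: since \<open>2 * q \<le> m\<close>, there is room for
  \<open>q\<close> points on at least one side of \<open>x\<close>.\<close>

lemma nat_window:
  assumes "x \<le> m" "2 * q \<le> (m::nat)"
  obtains W where "W \<subseteq> {1..m}" "card W = q" "\<And>w. w \<in> W \<Longrightarrow> \<bar>real w - real x\<bar> \<le> real q"
proof (cases "q \<le> x")
  case True
  show ?thesis by (rule that[of "{x - q<..x}"]) (use assms True in auto)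
next
  case False
  show ?thesis by (rule that[of "{x<..x + q}"]) (use assms False in auto)
qed

text \<open>A value above \<open>\<delta>\<close> persists, at half size, on a square of side \<open>\<delta> m / 4\<close>.\<close>

lemma sup_discrepancy_from_L2:
  assumes \<delta>: "0 < \<delta>" "\<delta> \<le> 1" and m: "real m \<ge> 8 / \<delta>" and t: "\<tau> permutes {1..m}"
    and L2: "(\<Sum>x\<in>{1..m}. \<Sum>y\<in>{1..m}. (discrepancy m \<tau> x y)\<^sup>2) / real m ^ 2 < \<delta> ^ 4 / 256"
    and xy: "x \<le> m" "y \<le> m"
  shows "\<bar>discrepancy m \<tau> x y\<bar> \<le> \<delta>"
proof (rule ccontr)
  assume "\<not> ?thesis"
  then have big: "\<delta> < \<bar>discrepancy m \<tau> x y\<bar>" by simp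
  have m0: "real m > 0" using m \<delta> by (smt (verit) divide_pos_pos)
  \<comment> \<open>Moving each coordinate by at most \<open>\<delta> * m / 4\<close> changes the
    discrepancy by at most \<open>\<delta> / 2\<close>. The lower bound on \<open>m\<close> ensures
    that rounding down still leaves \<open>q\<close> at least
    \<open>\<delta> * m / 8\<close>.\<close>
  define q where "q = nat \<lfloor>\<delta> * m / 4\<rfloor>"
  have "real q = real_of_int \<lfloor>\<delta> * m / 4\<rfloor>" using \<delta> by (simp add: q_def)
  then have q: "real q \<le> \<delta> * m / 4" "\<delta> * m / 4 - 1 < real q" by linarith+
  have "8 \<le> \<delta> * m" using m \<delta> by (simp add: field_simps)
  then have qge: "\<delta> * m / 8 \<le> real q" using q(2) by linarith
  have "\<delta> * m \<le> 1 * real m" using \<delta> by (intro mult_right_mono) auto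
  then have qm: "2 * q \<le> m" using q(1) by linarith
  obtain W where W: "W \<subseteq> {1..m}" "card W = q" "\<And>w. w \<in> W \<Longrightarrow> \<bar>real w - real x\<bar> \<le> real q"
    using nat_window[OF xy(1) qm] by blast
  obtain V where V: "V \<subseteq> {1..m}" "card V = q" "\<And>v. v \<in> V \<Longrightarrow> \<bar>real v - real y\<bar> \<le> real q"
    using nat_window[OF xy(2) qm] by blast
  have "(\<delta> / 2)\<^sup>2 \<le> (discrepancy m \<tau> w v)\<^sup>2" if "w \<in> W" "v \<in> V" for w v
  proof -
    have "\<bar>discrepancy m \<tau> w v - discrepancy m \<tau> x y\<bar> \<le> (\<bar>real w - real x\<bar> + \<bar>real v - real y\<bar>) / m"
      by (rule discrepancy_lipschitz) (use that W V xy m0 t in auto)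
    also have "\<dots> \<le> (\<delta> * m / 2) / m" using W(3)[OF that(1)] V(3)[OF that(2)] q(1) m0 by (intro divide_right_mono) auto
    also have "\<dots> = \<delta> / 2" using m0 by simp
    finally have "\<delta> / 2 \<le> \<bar>discrepancy m \<tau> w v\<bar>" using big by linarith
    then have "(\<delta> / 2)\<^sup>2 \<le> \<bar>discrepancy m \<tau> w v\<bar>\<^sup>2" using \<delta> by (intro power_mono) auto
    then show ?thesis by simp
  qed
  then have "(\<Sum>w\<in>W. \<Sum>v\<in>V. (\<delta> / 2)\<^sup>2) \<le> (\<Sum>w\<in>W. \<Sum>v\<in>V. (discrepancy m \<tau> w v)\<^sup>2)"
    by (intro sum_mono) auto
  also have "\<dots> \<le> (\<Sum>w\<in>W. \<Sum>v\<in>{1..m}. (discrepancy m \<tau> w v)\<^sup>2)"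
    using V by (intro sum_mono sum_mono2) auto
  also have "\<dots> \<le> (\<Sum>w\<in>{1..m}. \<Sum>v\<in>{1..m}. (discrepancy m \<tau> w v)\<^sup>2)"
    using W by (intro sum_mono2 sum_nonneg) auto
  also have "\<dots> < \<delta> ^ 4 / 256 * real m ^ 2"
    using L2 m0 by (simp add: field_simps)
  finally have "real q ^ 2 * (\<delta> / 2)\<^sup>2 < \<delta> ^ 4 / 256 * real m ^ 2"
    by (simp add: W V power2_eq_square mult.assoc)
  \<comment> \<open>The left side equals \<open>\<delta> ^ 4 / 256 * m ^ 2\<close>, which explains
    the constant in the hypothesis.\<close>
  moreover have "(\<delta> * m / 8)\<^sup>2 * (\<delta> / 2)\<^sup>2 \<le> real q ^ 2 * (\<delta> / 2)\<^sup>2"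
    using qge \<delta> by (intro mult_right_mono power_mono) auto
  ultimately show False by (simp add: field_simps power2_eq_square power4_eq_xxxx)
qed

subsection \<open>The mean square discrepancy\<close>

text \<open>Each of the two maximum conditions has probability 1/3 for a uniform order, and the two
  orders are asymptotically independent. The two triples of indices may overlap in any way.\<close>

lemma tendsto_max_event:
  fixes \<tau> :: "nat \<Rightarrow> nat \<Rightarrow> nat" and m :: "nat \<Rightarrow> nat"
  assumes m: "filterlim m at_top sequentially"
    and lim: "\<And>\<pi>. \<pi> permutes {1..k} \<Longrightarrow> (\<lambda>j. pattern_density k \<pi> (m j) (\<tau> j)) \<longlonglongrightarrow> 1 / fact k"
    and abc: "a \<in> {1..k}" "b \<in> {1..k}" "c \<in> {1..k}" "a \<noteq> b" "a \<noteq> c" "b \<noteq> c"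
    and abc': "a' \<in> {1..k}" "b' \<in> {1..k}" "c' \<in> {1..k}" "a' \<noteq> b'" "a' \<noteq> c'" "b' \<noteq> c'"
  shows "(\<lambda>j. card {x \<in> tuples k (m j). x b \<le> x a \<and> x c \<le> x a \<and>
      \<tau> j (x b') \<le> \<tau> j (x a') \<and> \<tau> j (x c') \<le> \<tau> j (x a')} / real (m j) ^ k) \<longlonglongrightarrow> 1 / 9"
proof -
  define M where "M a b c = {\<sigma>. \<sigma> permutes {1..k} \<and> \<sigma> b \<le> \<sigma> a \<and> \<sigma> c \<le> \<sigma> a}" for a b c
  have card: "real (card (M a b c)) / fact k = 1 / 3"
    if "a \<in> {1..k}" "b \<in> {1..k}" "c \<in> {1..k}" "a \<noteq> b" "a \<noteq> c" "b \<noteq> c" for a b c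
  proof -
    have "3 * card (M a b c) = fact k"
      using card_permutations_max_of_three[OF _ that] by (simp add: M_def)
    then have "3 * real (card (M a b c)) = fact k"
      by (metis of_nat_fact of_nat_mult of_nat_numeral)
    then show ?thesis by (simp add: field_simps)
  qed
  have "(\<lambda>j. card {x \<in> tuples k (m j). x b \<le> x a \<and> x c \<le> x a \<and>
      \<tau> j (x b') \<le> \<tau> j (x a') \<and> \<tau> j (x c') \<le> \<tau> j (x a')} / real (m j) ^ k)
    \<longlonglongrightarrow> (real (card (M a b c)) / fact k) * (real (card (M a' b' c')) / fact k)"
  proof (rule tendsto_order_event[OF m lim])
    fix j \<sigma> \<rho> x
    assume sr: "\<sigma> \<in> {\<sigma>. \<sigma> permutes {1..k}}" "\<rho> \<in> {\<sigma>. \<sigma> permutes {1..k}}"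
      and x: "x \<in> pattern_tuples k \<sigma> \<rho> (m j) (\<tau> j)"
    have "x i \<le> x l \<longleftrightarrow> \<sigma> i \<le> \<sigma> l" "\<tau> j (x i) \<le> \<tau> j (x l) \<longleftrightarrow> \<rho> i \<le> \<rho> l"
      if "i \<in> {1..k}" "l \<in> {1..k}" for i l
      using ordered_like_le_iff[of \<sigma> k x, OF _ _ that] ordered_like_le_iff[of \<rho> k "\<tau> j \<circ> x", OF _ _ that] sr x
      by (simp_all add: pattern_tuples_def)
    then show "x b \<le> x a \<and> x c \<le> x a \<and> \<tau> j (x b') \<le> \<tau> j (x a') \<and> \<tau> j (x c') \<le> \<tau> j (x a')
      \<longleftrightarrow> \<sigma> \<in> M a b c \<and> \<rho> \<in> M a' b' c'"
      using sr abc abc' by (simp add: M_def)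
  qed (auto simp: M_def)
  then show ?thesis unfolding card[OF abc] card[OF abc'] by simp
qed

section \<open>Three integrals of \<open>F\<close> as counts of four-point configurations\<close>

lemma sum_tuples_4:
  "(\<Sum>x\<in>tuples 4 m. f x) = (\<Sum>a\<in>{1..m}. \<Sum>b\<in>{1..m}. \<Sum>c\<in>{1..m}. \<Sum>d\<in>{1..m}.
    f ((\<lambda>_. undefined)(4 := d, 3 := c, 2 := b, 1 := a)))"
proof -
  have eq: "{1..4} = {1, 2, 3, 4::nat}" by auto
  have notin: "(1::nat) \<notin> {2, 3, 4}" "(2::nat) \<notin> {3, 4}" "(3::nat) \<notin> {4}" "(4::nat) \<notin> {}" by auto
  have empty: "(\<Sum>p\<in>{} \<rightarrow>\<^sub>E {1..m}. g p) = g (\<lambda>_. undefined)" for g by simp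
  show ?thesis unfolding tuples_def eq by (simp only: notin[THEN sum_PiE_insert] empty)
qed

lemma card_tuples_4:
  "real (card {x \<in> tuples 4 m. E (x 1) (x 2) (x 3) (x 4)}) =
    (\<Sum>a\<in>{1..m}. \<Sum>b\<in>{1..m}. \<Sum>c\<in>{1..m}. \<Sum>d\<in>{1..m}. of_bool (E a b c d))"
proof -
  have "real (card {x \<in> tuples 4 m. E (x 1) (x 2) (x 3) (x 4)}) = (\<Sum>x\<in>tuples 4 m. of_bool (E (x 1) (x 2) (x 3) (x 4)))"
    by (simp add: Int_def)
  then show ?thesis unfolding sum_tuples_4 by simp
qed

lemma dominated_altdef:
  assumes "x \<le> m"
  shows "dominated \<tau> x y = (\<Sum>i\<in>{1..m}. of_bool (i \<le> x \<and> \<tau> i \<le> y))"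
  unfolding dominated_def using assms by (intro sum.mono_neutral_cong_left) auto

lemma dominated_squared:
  assumes "x \<le> m"
  shows "(dominated \<tau> x y)\<^sup>2 = (\<Sum>i\<in>{1..m}. \<Sum>j\<in>{1..m}. of_bool (i \<le> x \<and> j \<le> x \<and> \<tau> i \<le> y \<and> \<tau> j \<le> y))"
  unfolding dominated_altdef[OF assms] power2_eq_square sum_product by (intro sum.cong refl) auto

text \<open>Point 1 supplies the abscissa and point 2, through reindexing by \<open>\<tau>\<close>,
  the ordinate of a uniform point of the square; points 3 and 4 are the two points that it
  dominates.\<close>

lemma sum_dominated_squared:
  assumes t: "\<tau> permutes {1..m}"
  shows "(\<Sum>x\<in>{1..m}. \<Sum>y\<in>{1..m}. (dominated \<tau> x y)\<^sup>2) =
    card {x \<in> tuples 4 m. x 3 \<le> x 1 \<and> x 4 \<le> x 1 \<and> \<tau> (x 3) \<le> \<tau> (x 2) \<and> \<tau> (x 4) \<le> \<tau> (x 2)}"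
proof -
  have "(\<Sum>x\<in>{1..m}. \<Sum>y\<in>{1..m}. (dominated \<tau> x y)\<^sup>2) = (\<Sum>x\<in>{1..m}. \<Sum>b\<in>{1..m}. (dominated \<tau> x (\<tau> b))\<^sup>2)"
    by (subst sum.permute[OF t]) (simp add: comp_def)
  also have "\<dots> = (\<Sum>a\<in>{1..m}. \<Sum>b\<in>{1..m}. \<Sum>c\<in>{1..m}. \<Sum>d\<in>{1..m}.
      of_bool (c \<le> a \<and> d \<le> a \<and> \<tau> c \<le> \<tau> b \<and> \<tau> d \<le> \<tau> b))"
    by (intro sum.cong refl dominated_squared) auto
  also have "\<dots> = card {x \<in> tuples 4 m. x 3 \<le> x 1 \<and> x 4 \<le> x 1 \<and> \<tau> (x 3) \<le> \<tau> (x 2) \<and> \<tau> (x 4) \<le> \<tau> (x 2)}"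
    by (rule card_tuples_4[symmetric])
  finally show ?thesis .
qed

text \<open>Three points suffice for this integral; the unconstrained fourth one produces the factor
  \<open>m\<close>.\<close>

lemma sum_dominated_diag_squared:
  "real m * (\<Sum>i\<in>{1..m}. (dominated \<tau> i (\<tau> i))\<^sup>2) =
    card {x \<in> tuples 4 m. x 2 \<le> x 1 \<and> x 3 \<le> x 1 \<and> \<tau> (x 2) \<le> \<tau> (x 1) \<and> \<tau> (x 3) \<le> \<tau> (x 1)}"
proof -
  have "real m * (\<Sum>i\<in>{1..m}. (dominated \<tau> i (\<tau> i))\<^sup>2) = (\<Sum>a\<in>{1..m}. \<Sum>b\<in>{1..m}. \<Sum>c\<in>{1..m}.
      real m * of_bool (b \<le> a \<and> c \<le> a \<and> \<tau> b \<le> \<tau> a \<and> \<tau> c \<le> \<tau> a))"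
    unfolding sum_distrib_left[symmetric]
    by (intro arg_cong2[where f = "(*)"] sum.cong refl dominated_squared) auto
  also have "\<dots> = (\<Sum>a\<in>{1..m}. \<Sum>b\<in>{1..m}. \<Sum>c\<in>{1..m}. \<Sum>d\<in>{1..m}.
      of_bool (b \<le> a \<and> c \<le> a \<and> \<tau> b \<le> \<tau> a \<and> \<tau> c \<le> \<tau> a))" by simp
  also have "\<dots> = card {x \<in> tuples 4 m. x 2 \<le> x 1 \<and> x 3 \<le> x 1 \<and> \<tau> (x 2) \<le> \<tau> (x 1) \<and> \<tau> (x 3) \<le> \<tau> (x 1)}"
    by (rule card_tuples_4[symmetric])
  finally show ?thesis .
qed

text \<open>Besides the dominated point 2, the factors \<open>i\<close> and \<open>\<tau> i\<close>
  are themselves counts: of points 3 not to the right of point 1 and of points 4 not above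
  it.\<close>

lemma sum_dominated_diag_product:
  assumes t: "\<tau> permutes {1..m}"
  shows "(\<Sum>i\<in>{1..m}. dominated \<tau> i (\<tau> i) * real i * real (\<tau> i)) =
    card {x \<in> tuples 4 m. x 2 \<le> x 1 \<and> x 3 \<le> x 1 \<and> \<tau> (x 2) \<le> \<tau> (x 1) \<and> \<tau> (x 4) \<le> \<tau> (x 1)}"
proof -
  have "dominated \<tau> a (\<tau> a) * real a * real (\<tau> a) = (\<Sum>b\<in>{1..m}. \<Sum>c\<in>{1..m}. \<Sum>d\<in>{1..m}.
      of_bool (b \<le> a \<and> c \<le> a \<and> \<tau> b \<le> \<tau> a \<and> \<tau> d \<le> \<tau> a))" if a: "a \<in> {1..m}" for a
  proof -
    have count: "(\<Sum>c\<in>{1..m}. of_bool (c \<le> y)) = real y" if "y \<in> {1..m}" for y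
    proof -
      have "{1..m} \<inter> {c. c \<le> y} = {1..y}" using that by auto
      then show ?thesis by simp
    qed
    have "real (\<tau> a) = (\<Sum>d\<in>{1..m}. of_bool (\<tau> d \<le> \<tau> a))"
      using count[of "\<tau> a"] permutes_in_image[OF t] a sum.permute[OF t, of "\<lambda>d. of_bool (d \<le> \<tau> a) :: real"]
      by (simp only: comp_def)
    moreover have "real a = (\<Sum>c\<in>{1..m}. of_bool (c \<le> a))" using count[OF a] by simp
    moreover have "dominated \<tau> a (\<tau> a) = (\<Sum>b\<in>{1..m}. of_bool (b \<le> a \<and> \<tau> b \<le> \<tau> a))"
      using a by (intro dominated_altdef) auto
    ultimately have "dominated \<tau> a (\<tau> a) * real a * real (\<tau> a) =
      (\<Sum>b\<in>{1..m}. of_bool (b \<le> a \<and> \<tau> b \<le> \<tau> a)) * ((\<Sum>c\<in>{1..m}. of_bool (c \<le> a)) * (\<Sum>d\<in>{1..m}. of_bool (\<tau> d \<le> \<tau> a)))"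
      by (simp only: mult.assoc)
    also have "\<dots> = (\<Sum>b\<in>{1..m}. \<Sum>c\<in>{1..m}. \<Sum>d\<in>{1..m}.
       of_bool (b \<le> a \<and> \<tau> b \<le> \<tau> a) * (of_bool (c \<le> a) * of_bool (\<tau> d \<le> \<tau> a)))"
      unfolding sum_product unfolding sum_distrib_left ..
    also have "\<dots> = (\<Sum>b\<in>{1..m}. \<Sum>c\<in>{1..m}. \<Sum>d\<in>{1..m}.
      of_bool (b \<le> a \<and> c \<le> a \<and> \<tau> b \<le> \<tau> a \<and> \<tau> d \<le> \<tau> a))"
      by (intro sum.cong refl) auto
    finally show ?thesis .
  qed
  then have "(\<Sum>i\<in>{1..m}. dominated \<tau> i (\<tau> i) * real i * real (\<tau> i)) = (\<Sum>a\<in>{1..m}. \<Sum>b\<in>{1..m}.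
      \<Sum>c\<in>{1..m}. \<Sum>d\<in>{1..m}. of_bool (b \<le> a \<and> c \<le> a \<and> \<tau> b \<le> \<tau> a \<and> \<tau> d \<le> \<tau> a))"
    by (rule sum.cong[OF refl])
  also have "\<dots> = card {x \<in> tuples 4 m. x 2 \<le> x 1 \<and> x 3 \<le> x 1 \<and> \<tau> (x 2) \<le> \<tau> (x 1) \<and> \<tau> (x 4) \<le> \<tau> (x 1)}"
    by (rule card_tuples_4[symmetric])
  finally show ?thesis .
qed

section \<open>Power sums and the mixed integral of \<open>xyF\<close> over the square\<close>

lemma sum_nat_tail: "i \<le> m \<Longrightarrow> i \<ge> 1 \<Longrightarrow> (\<Sum>x\<in>{i..m}. real x) = (real m * (real m + 1) - real i * (real i - 1)) / 2"
  by (induction m rule: dec_induct) (auto simp: field_simps)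

lemma sum_squares: "(\<Sum>i\<in>{1..m}. (real i)\<^sup>2) = real m * (real m + 1) * (2 * real m + 1) / 6"
  by (induction m) (auto simp: field_simps power2_eq_square)

lemma tendsto_sum_squares: "(\<lambda>m. (\<Sum>i\<in>{1..m}. (real i)\<^sup>2) / real m ^ 3) \<longlonglongrightarrow> 1 / 3"
proof -
  have "(\<lambda>m. (1 + 1 / real m) * (2 + 1 / real m) / 6) \<longlonglongrightarrow> (1 + 0) * (2 + 0) / 6"
    by (intro tendsto_intros lim_const_over_n) simp
  then have "(\<lambda>m. (1 + 1 / real m) * (2 + 1 / real m) / 6) \<longlonglongrightarrow> 1 / 3" by simp
  moreover have "\<forall>\<^sub>F m in sequentially. (1 + 1 / real m) * (2 + 1 / real m) / 6 = (\<Sum>i\<in>{1..m}. (real i)\<^sup>2) / real m ^ 3"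
    using eventually_ge_at_top[of 1]
    by eventually_elim (simp only: sum_squares, simp add: field_simps power3_eq_cube)
  ultimately show ?thesis by (rule Lim_transform_eventually)
qed

text \<open>Exchange of summation: a graph point \<open>(i, \<tau> i)\<close> is counted by exactly
  the grid points above and to the right of it.\<close>

lemma sum_dominated_product:
  assumes t: "\<tau> permutes {1..m}"
  shows "(\<Sum>x\<in>{1..m}. \<Sum>y\<in>{1..m}. dominated \<tau> x y * real x * real y) =
    (\<Sum>i\<in>{1..m}. (\<Sum>x\<in>{i..m}. real x) * (\<Sum>y\<in>{\<tau> i..m}. real y))"
proof -
  have "(\<Sum>x\<in>{1..m}. \<Sum>y\<in>{1..m}. dominated \<tau> x y * real x * real y) =
      (\<Sum>x\<in>{1..m}. \<Sum>y\<in>{1..m}. \<Sum>i\<in>{1..m}. of_bool (i \<le> x \<and> \<tau> i \<le> y) * real x * real y)"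
    unfolding sum_distrib_right[symmetric]
    by (intro sum.cong refl arg_cong2[where f = "(*)"] dominated_altdef) auto
  also have "\<dots> = (\<Sum>x\<in>{1..m}. \<Sum>i\<in>{1..m}. \<Sum>y\<in>{1..m}. of_bool (i \<le> x \<and> \<tau> i \<le> y) * real x * real y)"
    by (intro sum.cong refl sum.swap)
  also have "\<dots> = (\<Sum>i\<in>{1..m}. \<Sum>x\<in>{1..m}. \<Sum>y\<in>{1..m}. of_bool (i \<le> x \<and> \<tau> i \<le> y) * real x * real y)"
    by (rule sum.swap)
  also have "\<dots> = (\<Sum>i\<in>{1..m}. (\<Sum>x\<in>{1..m}. of_bool (i \<le> x) * real x) * (\<Sum>y\<in>{1..m}. of_bool (\<tau> i \<le> y) * real y))"
    unfolding sum_product by (intro sum.cong refl) auto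
  also have "\<dots> = (\<Sum>i\<in>{1..m}. (\<Sum>x\<in>{i..m}. real x) * (\<Sum>y\<in>{\<tau> i..m}. real y))"
  proof (intro sum.cong refl)
    have tail: "(\<Sum>x\<in>{1..m}. of_bool (i \<le> x) * real x) = (\<Sum>x\<in>{i..m}. real x)" if "i \<in> {1..m}" for i
      using that by (intro sum.mono_neutral_cong_right) auto
    fix i assume "i \<in> {1..m}"
    then show "(\<Sum>x\<in>{1..m}. of_bool (i \<le> x) * real x) * (\<Sum>y\<in>{1..m}. of_bool (\<tau> i \<le> y) * real y)
      = (\<Sum>x\<in>{i..m}. real x) * (\<Sum>y\<in>{\<tau> i..m}. real y)"
      using tail permutes_in_image[OF t] by presburger
  qed
  finally show ?thesis .
qed

text \<open>One-sided discrete form of the identity that integrates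
  \<open>(1 - x^2)(1 - y^2)/4\<close> over the graph. A lower bound is enough because the mixed term
  enters the mean square with a negative sign.\<close>

lemma sum_dominated_product_lower:
  assumes t: "\<tau> permutes {1..m}"
  shows "real m ^ 5 - 2 * real m ^ 2 * (\<Sum>i\<in>{1..m}. (real i)\<^sup>2) + (\<Sum>i\<in>{1..m}. (real i)\<^sup>2 * (real (\<tau> i))\<^sup>2)
    \<le> 4 * (\<Sum>x\<in>{1..m}. \<Sum>y\<in>{1..m}. dominated \<tau> x y * real x * real y)"
proof -
  \<comment> \<open>Twice the tail sum exceeds \<open>m^2 - i^2\<close> by \<open>m + i\<close>.
    Nonnegativity allows the two tail bounds to be multiplied.\<close>
  have tail: "0 \<le> (real m)\<^sup>2 - (real i)\<^sup>2 \<and> (real m)\<^sup>2 - (real i)\<^sup>2 \<le> 2 * (\<Sum>x\<in>{i..m}. real x)" if "i \<in> {1..m}" for i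
    using sum_nat_tail[of i m] that power_mono[of "real i" "real m" 2] by (simp add: algebra_simps power2_eq_square)
  have perm: "(\<Sum>i\<in>{1..m}. (real (\<tau> i))\<^sup>2) = (\<Sum>i\<in>{1..m}. (real i)\<^sup>2)"
    using sum.permute[OF t, of "\<lambda>i. (real i)\<^sup>2"] by (simp add: comp_def)
  have "(\<Sum>i\<in>{1..m}. ((real m)\<^sup>2 - (real i)\<^sup>2) * ((real m)\<^sup>2 - (real (\<tau> i))\<^sup>2))
    = (\<Sum>i\<in>{1..m}. real m ^ 4 - real m ^ 2 * (real i)\<^sup>2 - real m ^ 2 * (real (\<tau> i))\<^sup>2 + (real i)\<^sup>2 * (real (\<tau> i))\<^sup>2)"
    by (intro sum.cong refl) (simp add: algebra_simps power2_eq_square power4_eq_xxxx)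
  also have "\<dots> = real m ^ 5 - 2 * real m ^ 2 * (\<Sum>i\<in>{1..m}. (real i)\<^sup>2) + (\<Sum>i\<in>{1..m}. (real i)\<^sup>2 * (real (\<tau> i))\<^sup>2)"
    by (simp only: sum.distrib sum_subtractf sum_distrib_left[symmetric] perm) (simp add: eval_nat_numeral)
  finally have "real m ^ 5 - 2 * real m ^ 2 * (\<Sum>i\<in>{1..m}. (real i)\<^sup>2) + (\<Sum>i\<in>{1..m}. (real i)\<^sup>2 * (real (\<tau> i))\<^sup>2)
    = (\<Sum>i\<in>{1..m}. ((real m)\<^sup>2 - (real i)\<^sup>2) * ((real m)\<^sup>2 - (real (\<tau> i))\<^sup>2))" ..
  also have "\<dots> \<le> (\<Sum>i\<in>{1..m}. (2 * (\<Sum>x\<in>{i..m}. real x)) * (2 * (\<Sum>y\<in>{\<tau> i..m}. real y)))"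
  proof (rule sum_mono)
    fix i assume i: "i \<in> {1..m}"
    then have ti: "\<tau> i \<in> {1..m}" using permutes_in_image[OF t] by blast
    show "((real m)\<^sup>2 - (real i)\<^sup>2) * ((real m)\<^sup>2 - (real (\<tau> i))\<^sup>2)
      \<le> (2 * (\<Sum>x\<in>{i..m}. real x)) * (2 * (\<Sum>y\<in>{\<tau> i..m}. real y))"
      using tail[OF i] tail[OF ti] by (intro mult_mono) linarith+
  qed
  also have "\<dots> = 4 * (\<Sum>x\<in>{1..m}. \<Sum>y\<in>{1..m}. dominated \<tau> x y * real x * real y)"
    unfolding sum_dominated_product[OF t]
    by (subst sum_distrib_left[where A = "{1..m}"]) (rule sum.cong[OF refl], simp)
  finally show ?thesis .
qed

text \<open>The non-negative mean square of the discrepancy over the graph, with weight \<open>1/2\<close>, is dropped.\<close>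

lemma discrepancy_L2_bound:
  assumes m: "m > 0" and t: "\<tau> permutes {1..m}"
  defines "S \<equiv> (\<Sum>i\<in>{1..m}. (real i)\<^sup>2) / real m ^ 3"
  shows "(\<Sum>x\<in>{1..m}. \<Sum>y\<in>{1..m}. (discrepancy m \<tau> x y)\<^sup>2) / real m ^ 2
    \<le> (\<Sum>x\<in>{1..m}. \<Sum>y\<in>{1..m}. (dominated \<tau> x y)\<^sup>2) / real m ^ 4
      + real m * (\<Sum>i\<in>{1..m}. (dominated \<tau> i (\<tau> i))\<^sup>2) / real m ^ 4 / 2
      - (\<Sum>i\<in>{1..m}. dominated \<tau> i (\<tau> i) * real i * real (\<tau> i)) / real m ^ 4
      - 1 / 2 + S + S\<^sup>2"
proof -
  define n where "n = real m"
  have n: "n > 0" using m by (simp add: n_def)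
  define a1 where "a1 = (\<Sum>x\<in>{1..m}. \<Sum>y\<in>{1..m}. (dominated \<tau> x y)\<^sup>2)"
  define a2 where "a2 = (\<Sum>i\<in>{1..m}. (dominated \<tau> i (\<tau> i))\<^sup>2)"
  define a3 where "a3 = (\<Sum>i\<in>{1..m}. dominated \<tau> i (\<tau> i) * real i * real (\<tau> i))"
  define b where "b = (\<Sum>x\<in>{1..m}. \<Sum>y\<in>{1..m}. dominated \<tau> x y * real x * real y)"
  define c where "c = (\<Sum>i\<in>{1..m}. (real i)\<^sup>2 * (real (\<tau> i))\<^sup>2)"
  define s where "s = (\<Sum>i\<in>{1..m}. (real i)\<^sup>2)"
  have sq: "(discrepancy m \<tau> x y)\<^sup>2 = (dominated \<tau> x y)\<^sup>2 / n ^ 2 - 2 / n ^ 3 * (dominated \<tau> x y * real x * real y)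
      + (real x)\<^sup>2 * (real y)\<^sup>2 / n ^ 4" for x y
    unfolding discrepancy_def n_def[symmetric] using n by (simp add: field_simps power2_eq_square eval_nat_numeral)
  have L: "(\<Sum>x\<in>{1..m}. \<Sum>y\<in>{1..m}. (discrepancy m \<tau> x y)\<^sup>2) = a1 / n ^ 2 - 2 / n ^ 3 * b + s * s / n ^ 4"
    unfolding sq a1_def b_def s_def sum_product
    by (simp only: sum.distrib sum_subtractf sum_distrib_left sum_divide_distrib)
  have M: "(\<Sum>i\<in>{1..m}. (discrepancy m \<tau> i (\<tau> i))\<^sup>2) = a2 / n ^ 2 - 2 / n ^ 3 * a3 + c / n ^ 4"
    unfolding sq a2_def a3_def c_def
    by (simp only: sum.distrib sum_subtractf sum_distrib_left sum_divide_distrib)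
  have "0 \<le> (\<Sum>i\<in>{1..m}. (discrepancy m \<tau> i (\<tau> i))\<^sup>2)" by (intro sum_nonneg) auto
  then have "0 \<le> n ^ 4 * (a2 / n ^ 2 - 2 / n ^ 3 * a3 + c / n ^ 4)"
    using n unfolding M by (intro mult_nonneg_nonneg) auto
  also have "\<dots> = a2 * n ^ 2 - 2 * n * a3 + c"
    using n by (simp add: field_simps eval_nat_numeral)
  \<comment> \<open>The unknown moment \<open>c\<close> can be bounded only in this direction, from
    the nonnegative sum of squares over the graph.\<close>
  finally have c: "- c \<le> a2 * n ^ 2 - 2 * n * a3" by simp
  have "n ^ 5 - 2 * (n ^ 2 * s) + c \<le> 4 * b"
    using sum_dominated_product_lower[OF t] unfolding n_def s_def c_def b_def mult.assoc .
  \<comment> \<open>Adding half of each inequality cancels \<open>c\<close>; this is the origin of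
    the weight 1/2.\<close>
  moreover have "- 2 * b \<le> - u / 2 + v + w / 2" if "u - 2 * v + c \<le> 4 * b" "- c \<le> w" for u v w
    using that by linarith
  ultimately have "- 2 * b \<le> - (n ^ 5) / 2 + n ^ 2 * s + (a2 * n ^ 2 - 2 * n * a3) / 2" using c by blast
  then have "- 2 * b / n ^ 5 \<le> (- (n ^ 5) / 2 + n ^ 2 * s + (a2 * n ^ 2 - 2 * n * a3) / 2) / n ^ 5"
    using n by (intro divide_right_mono) auto
  also have "\<dots> = - 1 / 2 + s / n ^ 3 + n * a2 / n ^ 4 / 2 - a3 / n ^ 4"
    using n by (simp add: field_simps eval_nat_numeral)
  finally have B: "- 2 * b / n ^ 5 \<le> - 1 / 2 + s / n ^ 3 + n * a2 / n ^ 4 / 2 - a3 / n ^ 4" .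
  have "(a1 / n ^ 2 - 2 / n ^ 3 * b + s * s / n ^ 4) / n ^ 2 = a1 / n ^ 4 + (- 2 * b / n ^ 5) + (s / n ^ 3)\<^sup>2"
    using n by (simp add: field_simps eval_nat_numeral)
  with B show ?thesis
    unfolding S_def n_def[symmetric] s_def[symmetric] a1_def[symmetric] a2_def[symmetric] a3_def[symmetric] L
    by linarith
qed

lemma tendsto_discrepancy_L2:
  fixes \<tau> :: "nat \<Rightarrow> nat \<Rightarrow> nat" and m :: "nat \<Rightarrow> nat"
  assumes t: "\<And>j. j \<ge> 1 \<Longrightarrow> \<tau> j permutes {1..m j}" and m: "filterlim m at_top sequentially"
    and lim: "\<And>\<pi>. \<pi> permutes {1..4} \<Longrightarrow> (\<lambda>j. pattern_density 4 \<pi> (m j) (\<tau> j)) \<longlonglongrightarrow> 1 / fact 4"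
  shows "(\<lambda>j. (\<Sum>x\<in>{1..m j}. \<Sum>y\<in>{1..m j}. (discrepancy (m j) (\<tau> j) x y)\<^sup>2) / real (m j) ^ 2) \<longlonglongrightarrow> 0"
proof -
  define A1 where "A1 j = card {x \<in> tuples 4 (m j). x 3 \<le> x 1 \<and> x 4 \<le> x 1 \<and>
    \<tau> j (x 3) \<le> \<tau> j (x 2) \<and> \<tau> j (x 4) \<le> \<tau> j (x 2)} / real (m j) ^ 4" for j
  define A2 where "A2 j = card {x \<in> tuples 4 (m j). x 2 \<le> x 1 \<and> x 3 \<le> x 1 \<and>
    \<tau> j (x 2) \<le> \<tau> j (x 1) \<and> \<tau> j (x 3) \<le> \<tau> j (x 1)} / real (m j) ^ 4" for j
  define A3 where "A3 j = card {x \<in> tuples 4 (m j). x 2 \<le> x 1 \<and> x 3 \<le> x 1 \<and>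
    \<tau> j (x 2) \<le> \<tau> j (x 1) \<and> \<tau> j (x 4) \<le> \<tau> j (x 1)} / real (m j) ^ 4" for j
  define S where "S j = (\<Sum>i\<in>{1..m j}. (real i)\<^sup>2) / real (m j) ^ 3" for j
  have A: "A1 \<longlonglongrightarrow> 1 / 9" "A2 \<longlonglongrightarrow> 1 / 9" "A3 \<longlonglongrightarrow> 1 / 9"
    unfolding A1_def A2_def A3_def by (rule tendsto_max_event[OF m lim]; simp)+
  have S: "S \<longlonglongrightarrow> 1 / 3" unfolding S_def by (rule filterlim_compose[OF tendsto_sum_squares m])
  \<comment> \<open>The constants add up to exactly \<open>0\<close>, so the nonnegative mean square
    is squeezed to \<open>0\<close>.\<close>
  have "(\<lambda>j. A1 j + A2 j / 2 - A3 j - 1 / 2 + S j + (S j)\<^sup>2) \<longlonglongrightarrow> 1/9 + 1/9/2 - 1/9 - 1/2 + 1/3 + (1/3)\<^sup>2"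
    by (intro tendsto_intros A S) simp
  then have upper: "(\<lambda>j. A1 j + A2 j / 2 - A3 j - 1 / 2 + S j + (S j)\<^sup>2) \<longlonglongrightarrow> 0"
    by (simp add: power2_eq_square)
  have "\<forall>\<^sub>F j in sequentially. 1 \<le> m j" using m by (simp add: filterlim_at_top)
  then have "\<forall>\<^sub>F j in sequentially.
    (\<Sum>x\<in>{1..m j}. \<Sum>y\<in>{1..m j}. (discrepancy (m j) (\<tau> j) x y)\<^sup>2) / real (m j) ^ 2
      \<le> A1 j + A2 j / 2 - A3 j - 1 / 2 + S j + (S j)\<^sup>2"
    using eventually_ge_at_top[of 1]
  proof eventually_elim
    case (elim j)
    show ?case
      using discrepancy_L2_bound[OF _ t[OF elim(2)]] elim(1)
      unfolding A1_def A2_def A3_def S_def sum_dominated_squared[OF t[OF elim(2)]]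
        sum_dominated_diag_squared sum_dominated_diag_product[OF t[OF elim(2)]] by simp
  qed
  then show ?thesis
    by (rule tendsto_sandwich[OF always_eventually _ tendsto_const upper, rotated])
      (auto intro!: divide_nonneg_nonneg sum_nonneg)
qed

section \<open>Passage from four-point densities to densities of every order\<close>

theorem theorem1:
  fixes \<tau> :: "nat \<Rightarrow> nat \<Rightarrow> nat" and m :: "nat \<Rightarrow> nat"
  assumes "\<And>j. j \<ge> 1 \<Longrightarrow> m j \<ge> 1"
    and "\<And>j. j \<ge> 1 \<Longrightarrow> \<tau> j permutes {1..m j}"
    and "filterlim m at_top sequentially"
    and "\<And>\<pi>. \<pi> permutes {1..4} \<Longrightarrow>
           (\<lambda>j. pattern_density 4 \<pi> (m j) (\<tau> j)) \<longlonglongrightarrow> 1 / fact 4"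
  shows "\<forall>k\<ge>1. \<forall>\<pi>. \<pi> permutes {1..k} \<longrightarrow>
           (\<lambda>j. pattern_density k \<pi> (m j) (\<tau> j)) \<longlonglongrightarrow> 1 / fact k"
proof (intro allI impI)
  fix k :: nat and \<pi> assume k: "k \<ge> 1" and \<pi>: "\<pi> permutes {1..k}"
  note t = assms(2) and m = assms(3)
  define c where "c j = real (m j choose k) / real (m j) ^ k" for j
  define P where "P j = card (pattern_tuples k id \<pi> (m j) (\<tau> j)) / real (m j) ^ k" for j
  have c: "c \<longlonglongrightarrow> 1 / fact k"
    unfolding c_def by (rule filterlim_compose[OF tendsto_binomial_over_power m])
  \<comment> \<open>\<open>(c j)\<^sup>2\<close> is the value of \<open>P j\<close> for independent
    uniform points of the square. As the density is \<open>P j / c j\<close> once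
    \<open>k \<le> m j\<close>, it then has the same limit as \<open>c\<close>.\<close>
  have "(\<lambda>j. P j - (c j)\<^sup>2) \<longlonglongrightarrow> 0"
  proof (rule LIMSEQ_I)
    fix \<epsilon> :: real assume \<epsilon>: "\<epsilon> > 0"
    \<comment> \<open>The cap at 1 meets the hypothesis of \<open>sup_discrepancy_from_L2\<close>;
      the other term keeps the total exchange cost \<open>k * (4 * \<delta>)\<close> at most
      \<open>\<epsilon> / 2\<close>.\<close>
    define \<delta> where "\<delta> = min 1 (\<epsilon> / (8 * k))"
    have \<delta>: "0 < \<delta>" "\<delta> \<le> 1" "k * (4 * \<delta>) < \<epsilon>"
    proof -
      show "0 < \<delta>" "\<delta> \<le> 1" using \<epsilon> k by (auto simp: \<delta>_def)
      have "k * (4 * \<delta>) \<le> k * (4 * (\<epsilon> / (8 * k)))" by (intro mult_left_mono) (auto simp: \<delta>_def)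
      also have "\<dots> < \<epsilon>" using k \<epsilon> by simp
      finally show "k * (4 * \<delta>) < \<epsilon>" .
    qed
    have "\<forall>\<^sub>F j in sequentially. (\<Sum>x\<in>{1..m j}. \<Sum>y\<in>{1..m j}. (discrepancy (m j) (\<tau> j) x y)\<^sup>2) / real (m j) ^ 2 < \<delta> ^ 4 / 256"
      by (rule order_tendstoD(2)[OF tendsto_discrepancy_L2[OF t m assms(4)]]) (use \<delta> in auto)
    moreover have "\<forall>\<^sub>F j in sequentially. 8 / \<delta> \<le> real (m j)"
      using filterlim_compose[OF filterlim_real_sequentially m] by (simp add: filterlim_at_top)
    ultimately have "\<forall>\<^sub>F j in sequentially. norm (P j - (c j)\<^sup>2 - 0) < \<epsilon>"
      using eventually_ge_at_top[of 1]
    proof eventually_elim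
      case (elim j)
      have "\<bar>P j - (c j)\<^sup>2\<bar> \<le> k * (4 * \<delta>)"
        unfolding P_def c_def
        by (rule pattern_tuples_close_to_uniform[OF _ t[OF elim(3)] \<pi>])
          (use assms(1)[OF elim(3)] in simp,
            rule sup_discrepancy_from_L2[OF \<delta>(1,2) elim(2) t[OF elim(3)] elim(1)])
      then show ?case using \<delta>(3) by simp
    qed
    then show "\<exists>no. \<forall>j\<ge>no. norm (P j - (c j)\<^sup>2 - 0) < \<epsilon>" by (simp only: eventually_sequentially)
  qed
  from tendsto_add[OF this tendsto_power[OF c, of 2]]
  have "P \<longlonglongrightarrow> (1 / fact k)\<^sup>2" by simp
  from tendsto_divide[OF this c]
  have "(\<lambda>j. P j / c j) \<longlonglongrightarrow> 1 / fact k" by (simp add: power2_eq_square)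
  moreover have "\<forall>\<^sub>F j in sequentially. P j / c j = pattern_density k \<pi> (m j) (\<tau> j)"
  proof -
    have "\<forall>\<^sub>F j in sequentially. k \<le> m j" using m by (simp add: filterlim_at_top)
    then show ?thesis
    proof eventually_elim
      case (elim j)
      then show ?case
        using pattern_density_eq[OF permutes_id \<pi> elim] k by (simp add: P_def c_def)
    qed
  qed
  ultimately show "(\<lambda>j. pattern_density k \<pi> (m j) (\<tau> j)) \<longlonglongrightarrow> 1 / fact k"
    by (rule Lim_transform_eventually)
qed

end
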